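(* If $\mu\in\mathfrak{M}_x(\mathcal{G})$ is a measure on $\mathcal{G}$ whose support is a finite collection of realized types, then $\mu$ is idempotent if and only if $\mu = \frac{1}{|\mathcal{H}|}\sum_{a \in \mathcal{H}} \delta_{a}$ for some finite subgroup $\mathcal{H}$ of $\mathcal{G}$.
   Context: Setting: $T$ is an arbitrary first-order theory in a language $\mathcal{L}$ expanding a group, $\mathcal{G}$ is a sufficiently saturated (monster) model of $T$, and "small" means small relative to the saturation of $\mathcal{G}$. The variable $x$ (and $y$ in convolutions) is a singleton variable of the sort on which the group is defined. Keisler measures: for $A\subseteq\mathcal{G}$, $\mathcal{L}_x(A)$ is the Boolean algebra of formulas in $x$ with parameters from $A$ (up to equivalence), $S_x(A)$ is the space of types over $A$, and $\mathfrak{M}_x(A)$ is the set of Keisler measures over $A$, i.e. finitely additive probability measures on $\mathcal{L}_x(A)$; each is identified with the corresponding regular Borel probability measure on $S_x(A)$. $\mu|_A$ denotes restriction. The support of $\mu\in\mathfrak{M}_x(A)$ is $S(\mu)=\{p\in S_x(A):\mu(\varphi(x))>0 \text{ for all }\varphi(x)\in p\}$. A realized type is $\mathrm{tp}(a/\mathcal{G})$ with $a\in\mathcal{G}$, and $\delta_a$ is the corresponding Dirac measure: $\delta_a(\varphi(x))=1$ if $\mathcal{G}\models\varphi(a)$ and $0$ otherwise. Convolution: for $\mu,\nu\in\mathfrak{M}_x(\mathcal{G})$ let $\nu_y$ be $\nu$ viewed as a measure in the variable $y$. The pair $(\mu,\nu)$ is $*$-Borel if for every $\varphi(x,\bar c)\in\mathcal{L}_x(\mathcal{G})$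 there is a small $N\prec\mathcal{G}$ containing $\bar c$ such that for every $q\in S(\nu_y|_N)$ the value $F(q):=\mu(\varphi(x\cdot d,\bar c))$ is the same for all $d\models q$ in $\mathcal{G}$, and $F:S(\nu_y|_N)\to[0,1]$ is Borel. Then $(\mu*\nu)(\varphi(x,\bar c)):=\int_{S(\nu_y|_N)}F\,d\nu_N$, where $\nu_N$ is the Borel measure $\nu_y|_N$ restricted to its support (this does not depend on $N$). $\mu$ is idempotent if $(\mu,\mu)$ is $*$-Borel and $\mu*\mu=\mu$. *)

theory Defs
  imports "HOL-Probability.Probability" "HOL-Algebra.Group"
begin

unbundle cardinal_syntax

section \<open>Many-sorted first-order logic with parameters\<close>

record ('s, 'f, 'r) lang =
  funs :: "'f set"
  rels :: "'r set"
  fun_type :: "'f \<Rightarrow> 's list \<times> 's"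
  rel_type :: "'r \<Rightarrow> 's list"

record ('s, 'f, 'r, 'a) struct =
  univ :: "'s \<Rightarrow> 'a set"
  fint :: "'f \<Rightarrow> 'a list \<Rightarrow> 'a"
  rint :: "'r \<Rightarrow> 'a list \<Rightarrow> bool"

text \<open>Variables carry their sort. \<open>Par s a\<close> is the constant symbol naming the element \<open>a\<close> of
  sort \<open>s\<close> (sorts are not required to be disjoint), so that formulas over a parameter set are the
  formulas of the language expanded by constants.\<close>

type_synonym 's var = "'s \<times> nat"

datatype (dead 's, dead 'f, dead 'a) trm =
  Var "'s var" | Par 's 'a | App 'f "('s, 'f, 'a) trm list"

datatype (dead 's, dead 'f, dead 'r, dead 'a) fm =
  Eq "('s, 'f, 'a) trm" "('s, 'f, 'a) trm"
| Rel 'r "('s, 'f, 'a) trm list"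
| Neg "('s, 'f, 'r, 'a) fm"
| Conj "('s, 'f, 'r, 'a) fm" "('s, 'f, 'r, 'a) fm"
| Ex "'s var" "('s, 'f, 'r, 'a) fm"

text \<open>Parameter sets \<open>A\<close> are families of sets indexed by the sorts.\<close>

inductive has_sort ::
  "('s, 'f, 'r) lang \<Rightarrow> ('s \<Rightarrow> 'a set) \<Rightarrow> ('s, 'f, 'a) trm \<Rightarrow> 's \<Rightarrow> bool"
  for L A where
  "has_sort L A (Var (s, n)) s"
| "a \<in> A s \<Longrightarrow> has_sort L A (Par s a) s"
| "f \<in> funs L \<Longrightarrow> fun_type L f = (ss, s) \<Longrightarrow> list_all2 (has_sort L A) ts ss
    \<Longrightarrow> has_sort L A (App f ts) s"

primrec wf_fm :: "('s, 'f, 'r) lang \<Rightarrow> ('s \<Rightarrow> 'a set) \<Rightarrow> ('s, 'f, 'r, 'a) fm \<Rightarrow> bool" where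
  "wf_fm L A (Eq t u) \<longleftrightarrow> (\<exists>s. has_sort L A t s \<and> has_sort L A u s)"
| "wf_fm L A (Rel r ts) \<longleftrightarrow> r \<in> rels L \<and> list_all2 (has_sort L A) ts (rel_type L r)"
| "wf_fm L A (Neg \<phi>) \<longleftrightarrow> wf_fm L A \<phi>"
| "wf_fm L A (Conj \<phi> \<psi>) \<longleftrightarrow> wf_fm L A \<phi> \<and> wf_fm L A \<psi>"
| "wf_fm L A (Ex v \<phi>) \<longleftrightarrow> wf_fm L A \<phi>"

primrec fv_trm :: "('s, 'f, 'a) trm \<Rightarrow> 's var set" where
  "fv_trm (Var v) = {v}"
| "fv_trm (Par s a) = {}"
| "fv_trm (App f ts) = \<Union> (set (map fv_trm ts))"

primrec fv :: "('s, 'f, 'r, 'a) fm \<Rightarrow> 's var set" where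
  "fv (Eq t u) = fv_trm t \<union> fv_trm u"
| "fv (Rel r ts) = \<Union> (set (map fv_trm ts))"
| "fv (Neg \<phi>) = fv \<phi>"
| "fv (Conj \<phi> \<psi>) = fv \<phi> \<union> fv \<psi>"
| "fv (Ex v \<phi>) = fv \<phi> - {v}"

definition formulas :: "('s, 'f, 'r) lang \<Rightarrow> ('s \<Rightarrow> 'a set) \<Rightarrow> ('s, 'f, 'r, 'a) fm set" where
  "formulas L A = {\<phi>. wf_fm L A \<phi>}"

definition sentences :: "('s, 'f, 'r) lang \<Rightarrow> ('s \<Rightarrow> 'a set) \<Rightarrow> ('s, 'f, 'r, 'a) fm set" where
  "sentences L A = {\<phi> \<in> formulas L A. fv \<phi> = {}}"

primrec eval :: "('s, 'f, 'r, 'a) struct \<Rightarrow> ('s var \<Rightarrow> 'a) \<Rightarrow> ('s, 'f, 'a) trm \<Rightarrow> 'a" where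
  "eval M e (Var v) = e v"
| "eval M e (Par s a) = a"
| "eval M e (App f ts) = fint M f (map (eval M e) ts)"

primrec sat :: "('s, 'f, 'r, 'a) struct \<Rightarrow> ('s var \<Rightarrow> 'a) \<Rightarrow> ('s, 'f, 'r, 'a) fm \<Rightarrow> bool" where
  "sat M e (Eq t u) \<longleftrightarrow> eval M e t = eval M e u"
| "sat M e (Rel r ts) \<longleftrightarrow> rint M r (map (eval M e) ts)"
| "sat M e (Neg \<phi>) \<longleftrightarrow> \<not> sat M e \<phi>"
| "sat M e (Conj \<phi> \<psi>) \<longleftrightarrow> sat M e \<phi> \<and> sat M e \<psi>"
| "sat M e (Ex v \<phi>) \<longleftrightarrow> (\<exists>a \<in> univ M (fst v). sat M (e(v := a)) \<phi>)"

text \<open>Truth of a sentence does not depend on the assignment, so an arbitrary one is used.\<close>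

definition holds :: "('s, 'f, 'r, 'a) struct \<Rightarrow> ('s, 'f, 'r, 'a) fm \<Rightarrow> bool" where
  "holds M \<phi> \<longleftrightarrow> sat M (\<lambda>_. undefined) \<phi>"

definition is_structure :: "('s, 'f, 'r) lang \<Rightarrow> ('s, 'f, 'r, 'a) struct \<Rightarrow> bool" where
  "is_structure L M \<longleftrightarrow>
     (\<forall>s. univ M s \<noteq> {}) \<and>
     (\<forall>f \<in> funs L. \<forall>as. list_all2 (\<lambda>a s. a \<in> univ M s) as (fst (fun_type L f))
        \<longrightarrow> fint M f as \<in> univ M (snd (fun_type L f)))"

definition is_model ::
  "('s, 'f, 'r) lang \<Rightarrow> ('s, 'f, 'r, 'a) fm set \<Rightarrow> ('s, 'f, 'r, 'a) struct \<Rightarrow> bool" where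
  "is_model L T M \<longleftrightarrow> is_structure L M \<and> (\<forall>\<phi> \<in> T. holds M \<phi>)"

definition elementary_sub ::
  "('s, 'f, 'r) lang \<Rightarrow> ('s, 'f, 'r, 'a) struct \<Rightarrow> ('s \<Rightarrow> 'a set) \<Rightarrow> bool" where
  "elementary_sub L M N \<longleftrightarrow>
     (\<forall>s. N s \<subseteq> univ M s) \<and> is_structure L (M\<lparr>univ := N\<rparr>) \<and>
     (\<forall>\<phi> \<in> sentences L N. holds (M\<lparr>univ := N\<rparr>) \<phi> \<longleftrightarrow> holds M \<phi>)"

definition small :: "'k rel \<Rightarrow> ('s \<Rightarrow> 'a set) \<Rightarrow> bool" where
  "small \<kappa> A \<longleftrightarrow> |SIGMA s : UNIV. A s| <o \<kappa>"


section \<open>Formulas up to equivalence, types and saturation\<close>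

definition xvar :: "'s \<Rightarrow> 's var" where
  "xvar s = (s, 0)"

definition xformulas ::
  "('s, 'f, 'r) lang \<Rightarrow> 's \<Rightarrow> ('s \<Rightarrow> 'a set) \<Rightarrow> ('s, 'f, 'r, 'a) fm set" where
  "xformulas L s A = {\<phi> \<in> formulas L A. fv \<phi> \<subseteq> {xvar s}}"

definition solutions :: "('s, 'f, 'r, 'a) struct \<Rightarrow> 's \<Rightarrow> ('s, 'f, 'r, 'a) fm \<Rightarrow> 'a set" where
  "solutions M s \<phi> = {a \<in> univ M s. sat M ((\<lambda>_. undefined)(xvar s := a)) \<phi>}"

text \<open>The Boolean algebra of formulas in \<open>x\<close> over \<open>A\<close>, up to equivalence in \<open>M\<close>: the class of a
  formula is represented by its set of solutions in \<open>M\<close>.\<close>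

definition Lx ::
  "('s, 'f, 'r) lang \<Rightarrow> ('s, 'f, 'r, 'a) struct \<Rightarrow> 's \<Rightarrow> ('s \<Rightarrow> 'a set) \<Rightarrow> 'a set set" where
  "Lx L M s A = solutions M s ` xformulas L s A"

text \<open>Complete types over \<open>A\<close>: sets of formulas over \<open>A\<close> which are finitely satisfiable
  in \<open>M\<close> and decide every formula over \<open>A\<close>, i.e. the ultrafilters of \<open>Lx L M s A\<close>.\<close>

definition types ::
  "('s, 'f, 'r) lang \<Rightarrow> ('s, 'f, 'r, 'a) struct \<Rightarrow> 's \<Rightarrow> ('s \<Rightarrow> 'a set) \<Rightarrow> 'a set set set" where
  "types L M s A = {p. p \<subseteq> Lx L M s A \<and>
     (\<forall>F. finite F \<longrightarrow> F \<subseteq> p \<longrightarrow> (\<exists>a \<in> univ M s. \<forall>X \<in> F. a \<in> X)) \<and>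
     (\<forall>X \<in> Lx L M s A. X \<in> p \<or> univ M s - X \<in> p)}"

definition realizes :: "('s, 'f, 'r, 'a) struct \<Rightarrow> 's \<Rightarrow> 'a \<Rightarrow> 'a set set \<Rightarrow> bool" where
  "realizes M s d p \<longleftrightarrow> d \<in> univ M s \<and> (\<forall>X \<in> p. d \<in> X)"

definition tp ::
  "('s, 'f, 'r) lang \<Rightarrow> ('s, 'f, 'r, 'a) struct \<Rightarrow> 's \<Rightarrow> ('s \<Rightarrow> 'a set) \<Rightarrow> 'a \<Rightarrow> 'a set set" where
  "tp L M s A a = {X \<in> Lx L M s A. a \<in> X}"

definition saturated ::
  "('s, 'f, 'r) lang \<Rightarrow> ('s, 'f, 'r, 'a) struct \<Rightarrow> 'k rel \<Rightarrow> bool" where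
  "saturated L M \<kappa> \<longleftrightarrow>
     (\<forall>A. (\<forall>s. A s \<subseteq> univ M s) \<longrightarrow> small \<kappa> A \<longrightarrow>
        (\<forall>s. \<forall>p \<in> types L M s A. \<exists>d. realizes M s d p))"

text \<open>Sufficiently saturated means \<open>\<kappa>\<close>-saturated for a cardinal \<open>\<kappa>\<close> larger than the language,
  whose cardinality is taken to be the number of formulas without parameters (so at least
  \<open>\<aleph>\<^sub>0\<close>); small means of cardinality less than \<open>\<kappa>\<close>.\<close>

definition monster_model ::
  "('s, 'f, 'r) lang \<Rightarrow> ('s, 'f, 'r, 'a) fm set \<Rightarrow> ('s, 'f, 'r, 'a) struct \<Rightarrow> 'k rel \<Rightarrow> bool" where
  "monster_model L T M \<kappa> \<longleftrightarrow>
     T \<subseteq> sentences L (\<lambda>_. {}) \<and> is_model L T M \<and>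
     Card_order \<kappa> \<and> |formulas L (\<lambda>_. {}) :: ('s, 'f, 'r, 'a) fm set| <o \<kappa> \<and>
     saturated L M \<kappa>"

definition expands_group ::
  "('s, 'f, 'r) lang \<Rightarrow> ('s, 'f, 'r, 'a) struct \<Rightarrow> 's \<Rightarrow> 'f \<Rightarrow> 'a monoid \<Rightarrow> bool" where
  "expands_group L M g m G \<longleftrightarrow>
     group G \<and> carrier G = univ M g \<and>
     m \<in> funs L \<and> fun_type L m = ([g, g], g) \<and>
     (\<forall>a \<in> carrier G. \<forall>b \<in> carrier G. fint M m [a, b] = a \<otimes>\<^bsub>G\<^esub> b)"


section \<open>Keisler measures\<close>

text \<open>Measures are functions on the Boolean algebra; as HOL functions they are normalised to be
  \<open>undefined\<close> outside it, so that equality of measures is equality of functions.\<close>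

definition keisler_measures ::
  "('s, 'f, 'r) lang \<Rightarrow> ('s, 'f, 'r, 'a) struct \<Rightarrow> 's \<Rightarrow> ('s \<Rightarrow> 'a set) \<Rightarrow> ('a set \<Rightarrow> real) set"
  where
  "keisler_measures L M s A = {\<mu> \<in> extensional (Lx L M s A).
     (\<forall>X \<in> Lx L M s A. 0 \<le> \<mu> X) \<and> \<mu> (univ M s) = 1 \<and>
     (\<forall>X \<in> Lx L M s A. \<forall>Y \<in> Lx L M s A. X \<inter> Y = {} \<longrightarrow> \<mu> (X \<union> Y) = \<mu> X + \<mu> Y)}"

definition support ::
  "('s, 'f, 'r) lang \<Rightarrow> ('s, 'f, 'r, 'a) struct \<Rightarrow> 's \<Rightarrow> ('s \<Rightarrow> 'a set) \<Rightarrow> ('a set \<Rightarrow> real)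
    \<Rightarrow> 'a set set set" where
  "support L M s A \<mu> = {p \<in> types L M s A. \<forall>X \<in> p. \<mu> X > 0}"

definition dirac ::
  "('s, 'f, 'r) lang \<Rightarrow> ('s, 'f, 'r, 'a) struct \<Rightarrow> 's \<Rightarrow> 'a \<Rightarrow> 'a set \<Rightarrow> real" where
  "dirac L M s a = (\<lambda>X \<in> Lx L M s (univ M). if a \<in> X then 1 else 0)"

definition type_topology ::
  "('s, 'f, 'r) lang \<Rightarrow> ('s, 'f, 'r, 'a) struct \<Rightarrow> 's \<Rightarrow> ('s \<Rightarrow> 'a set) \<Rightarrow> 'a set set topology"
  where
  "type_topology L M s A =
     topology_generated_by ((\<lambda>X. {p \<in> types L M s A. X \<in> p}) ` Lx L M s A)"

definition type_borel ::
  "('s, 'f, 'r) lang \<Rightarrow> ('s, 'f, 'r, 'a) struct \<Rightarrow> 's \<Rightarrow> ('s \<Rightarrow> 'a set) \<Rightarrow> 'a set set measure"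
  where
  "type_borel L M s A = sigma (types L M s A) {U. openin (type_topology L M s A) U}"

definition regular_measure :: "'b topology \<Rightarrow> 'b measure \<Rightarrow> bool" where
  "regular_measure X m \<longleftrightarrow> (\<forall>B \<in> sets m.
     emeasure m B = (INF U \<in> {U. openin X U \<and> B \<subseteq> U}. emeasure m U) \<and>
     emeasure m B = (SUP K \<in> {K. compactin X K \<and> K \<subseteq> B}. emeasure m K))"

text \<open>The unique regular Borel probability measure on the type space which extends \<open>\<mu>\<close>.\<close>

definition borel_extension ::
  "('s, 'f, 'r) lang \<Rightarrow> ('s, 'f, 'r, 'a) struct \<Rightarrow> 's \<Rightarrow> ('s \<Rightarrow> 'a set) \<Rightarrow> ('a set \<Rightarrow> real)
    \<Rightarrow> 'a set set measure" where
  "borel_extension L M s A \<mu> = (THE m.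
     space m = types L M s A \<and> sets m = sets (type_borel L M s A) \<and> prob_space m \<and>
     regular_measure (type_topology L M s A) m \<and>
     (\<forall>X \<in> Lx L M s A. measure m {p \<in> types L M s A. X \<in> p} = \<mu> X))"


section \<open>Convolution\<close>

text \<open>The solution set of \<open>\<phi>(x \<cdot> d)\<close>.\<close>

definition translate ::
  "('s, 'f, 'r, 'a) struct \<Rightarrow> 's \<Rightarrow> 'a monoid \<Rightarrow> ('s, 'f, 'r, 'a) fm \<Rightarrow> 'a \<Rightarrow> 'a set" where
  "translate M g G \<phi> d = {a \<in> univ M g. a \<otimes>\<^bsub>G\<^esub> d \<in> solutions M g \<phi>}"

text \<open>The function \<open>F\<close>, computed with some realization \<open>d\<close> of \<open>q\<close>; independence of \<open>d\<close> is
  part of the definition of \<open>good_submodel\<close>.\<close>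

definition fiber_value ::
  "('s, 'f, 'r, 'a) struct \<Rightarrow> 's \<Rightarrow> 'a monoid \<Rightarrow> ('a set \<Rightarrow> real) \<Rightarrow> ('s, 'f, 'r, 'a) fm
    \<Rightarrow> 'a set set \<Rightarrow> real" where
  "fiber_value M g G \<mu> \<phi> q = \<mu> (translate M g G \<phi> (SOME d. realizes M g d q))"

text \<open>\<open>N\<close> witnesses the Borel condition for the formula \<open>\<phi>\<close>; that \<open>\<phi>\<close> is a formula over \<open>N\<close>
  says that \<open>N\<close> contains its parameters.\<close>

definition good_submodel ::
  "('s, 'f, 'r) lang \<Rightarrow> ('s, 'f, 'r, 'a) struct \<Rightarrow> 'k rel \<Rightarrow> 's \<Rightarrow> 'a monoid
    \<Rightarrow> ('a set \<Rightarrow> real) \<Rightarrow> ('a set \<Rightarrow> real) \<Rightarrow> ('s, 'f, 'r, 'a) fm \<Rightarrow> ('s \<Rightarrow> 'a set) \<Rightarrow> bool" where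
  "good_submodel L M \<kappa> g G \<mu> \<nu> \<phi> N \<longleftrightarrow>
     elementary_sub L M N \<and> small \<kappa> N \<and> \<phi> \<in> xformulas L g N \<and>
     (let S = support L M g N (restrict \<nu> (Lx L M g N)) in
        (\<forall>q \<in> S. \<forall>d d'. realizes M g d q \<longrightarrow> realizes M g d' q \<longrightarrow>
           \<mu> (translate M g G \<phi> d) = \<mu> (translate M g G \<phi> d')) \<and>
        fiber_value M g G \<mu> \<phi> \<in> borel_measurable (restrict_space (type_borel L M g N) S))"

definition star_borel ::
  "('s, 'f, 'r) lang \<Rightarrow> ('s, 'f, 'r, 'a) struct \<Rightarrow> 'k rel \<Rightarrow> 's \<Rightarrow> 'a monoid
    \<Rightarrow> ('a set \<Rightarrow> real) \<Rightarrow> ('a set \<Rightarrow> real) \<Rightarrow> bool" where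
  "star_borel L M \<kappa> g G \<mu> \<nu> \<longleftrightarrow>
     (\<forall>\<phi> \<in> xformulas L g (univ M). \<exists>N. good_submodel L M \<kappa> g G \<mu> \<nu> \<phi> N)"

definition fiber_integral ::
  "('s, 'f, 'r) lang \<Rightarrow> ('s, 'f, 'r, 'a) struct \<Rightarrow> 's \<Rightarrow> 'a monoid
    \<Rightarrow> ('a set \<Rightarrow> real) \<Rightarrow> ('a set \<Rightarrow> real) \<Rightarrow> ('s, 'f, 'r, 'a) fm \<Rightarrow> ('s \<Rightarrow> 'a set) \<Rightarrow> real" where
  "fiber_integral L M g G \<mu> \<nu> \<phi> N =
     (let \<nu>N = restrict \<nu> (Lx L M g N) in
      integral\<^sup>L (restrict_space (borel_extension L M g N \<nu>N) (support L M g N \<nu>N))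
        (fiber_value M g G \<mu> \<phi>))"

text \<open>The integral does not depend on the formula \<open>\<phi>\<close> representing \<open>X\<close> nor on \<open>N\<close>; a pair is
  chosen. The definition is meaningful only for \<open>*\<close>-Borel pairs.\<close>

definition convolution ::
  "('s, 'f, 'r) lang \<Rightarrow> ('s, 'f, 'r, 'a) struct \<Rightarrow> 'k rel \<Rightarrow> 's \<Rightarrow> 'a monoid
    \<Rightarrow> ('a set \<Rightarrow> real) \<Rightarrow> ('a set \<Rightarrow> real) \<Rightarrow> 'a set \<Rightarrow> real" where
  "convolution L M \<kappa> g G \<mu> \<nu> = (\<lambda>X \<in> Lx L M g (univ M).
     (case (SOME (\<phi>, N). \<phi> \<in> xformulas L g (univ M) \<and> solutions M g \<phi> = X \<and>
               good_submodel L M \<kappa> g G \<mu> \<nu> \<phi> N) of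
        (\<phi>, N) \<Rightarrow> fiber_integral L M g G \<mu> \<nu> \<phi> N))"

definition idempotent_measure ::
  "('s, 'f, 'r) lang \<Rightarrow> ('s, 'f, 'r, 'a) struct \<Rightarrow> 'k rel \<Rightarrow> 's \<Rightarrow> 'a monoid
    \<Rightarrow> ('a set \<Rightarrow> real) \<Rightarrow> bool" where
  "idempotent_measure L M \<kappa> g G \<mu> \<longleftrightarrow>
     star_borel L M \<kappa> g G \<mu> \<mu> \<and> convolution L M \<kappa> g G \<mu> \<mu> = \<mu>"

end

theory Submission
  imports Defs
begin

text \<open>Every formula of positive \<open>\<mu>\<close>-measure lies in some type of the support. If the support
  consists of finitely many realized types, the complement of their realizations is therefore null,
  and \<open>\<mu>\<close> is a finite combination of Dirac measures at a set \<open>S\<close> of atoms with positive weights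
  \<open>w\<close> of sum 1 (\<open>finite_realized_support_imp_atomic\<close>).

  For such a measure the convolution is the expected finite sum
  \<open>(\<mu> * \<mu>)(X) = (\<Sum>b\<in>S. w b * \<mu> (X \<cdot> b\<^sup>-\<^sup>1))\<close>. Two things must be checked. First, the pair
  \<open>(\<mu>, \<mu>)\<close> is \<open>*\<close>-Borel: by the downward Loewenheim-Skolem theorem there is a small elementary
  submodel \<open>N\<close> that contains the atoms and the parameters of the formula, and over this \<open>N\<close> the
  support is a finite set of types with one realization each (\<open>star_borel_atomic\<close>). Secondly, the
  integral over the type space is that sum: the measure with point masses \<open>w a\<close> at the types
  \<open>tp(a/N)\<close> is regular and extends \<open>\<mu>\<close>, and a regular extension is unique
  (\<open>borel_extension_atomic\<close>).

  Hence idempotence is a statement about the weights (\<open>idempotent_atomic_iff\<close>). Tested on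
  singletons, which are definable with parameters, it says that the distribution \<open>w\<close> on the group is
  equal to its own convolution square. Then the set \<open>S\<close> of atoms is closed under multiplication, so
  it is a subgroup as it is finite, and a maximum argument shows that \<open>w\<close> is constant on it
  (\<open>idempotent_weights\<close>). Conversely the uniform distribution on a finite subgroup is invariant
  under right translation by its elements.\<close>

section \<open>Formulas: parameters, free variables and truth\<close>

lemma has_sort_simps [simp]:
  "has_sort L A (Var v) s \<longleftrightarrow> fst v = s"
  "has_sort L A (Par s' a) s \<longleftrightarrow> s' = s \<and> a \<in> A s"
  "has_sort L A (App f ts) s \<longleftrightarrow>
     f \<in> funs L \<and> snd (fun_type L f) = s \<and> list_all2 (has_sort L A) ts (fst (fun_type L f))"
  by (cases v; fastforce elim: has_sort.cases intro: has_sort.intros)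
    (auto elim: has_sort.cases intro: has_sort.intros simp: prod_eq_iff)

primrec params_trm :: "('s, 'f, 'a) trm \<Rightarrow> ('s \<times> 'a) set" where
  "params_trm (Var v) = {}"
| "params_trm (Par s a) = {(s, a)}"
| "params_trm (App f ts) = \<Union> (set (map params_trm ts))"

primrec params :: "('s, 'f, 'r, 'a) fm \<Rightarrow> ('s \<times> 'a) set" where
  "params (Eq t u) = params_trm t \<union> params_trm u"
| "params (Rel r ts) = \<Union> (set (map params_trm ts))"
| "params (Neg \<phi>) = params \<phi>"
| "params (Conj \<phi> \<psi>) = params \<phi> \<union> params \<psi>"
| "params (Ex v \<phi>) = params \<phi>"

primrec bound_vars :: "('s, 'f, 'r, 'a) fm \<Rightarrow> 's var set" where
  "bound_vars (Eq t u) = {}"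
| "bound_vars (Rel r ts) = {}"
| "bound_vars (Neg \<phi>) = bound_vars \<phi>"
| "bound_vars (Conj \<phi> \<psi>) = bound_vars \<phi> \<union> bound_vars \<psi>"
| "bound_vars (Ex v \<phi>) = insert v (bound_vars \<phi>)"

lemma finite_params_trm: "finite (params_trm t)"
  by (induction t) auto

lemma finite_params: "finite (params \<phi>)"
  by (induction \<phi>) (auto simp: finite_params_trm)

lemma finite_fv_trm: "finite (fv_trm t)"
  by (induction t) auto

lemma finite_fv: "finite (fv \<phi>)"
  by (induction \<phi>) (auto simp: finite_fv_trm)

lemma finite_bound_vars: "finite (bound_vars \<phi>)"
  by (induction \<phi>) auto

lemma has_sort_params: "has_sort L A t s \<Longrightarrow> params_trm t \<subseteq> Sigma UNIV A"
proof (induction t arbitrary: s)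
  case (App f ts)
  have "params_trm t \<subseteq> Sigma UNIV A" if t: "t \<in> set ts" for t
  proof -
    from App.prems t obtain s' where "has_sort L A t s'"
      by (auto simp: list_all2_conv_all_nth in_set_conv_nth)
    with App.IH t show ?thesis by blast
  qed
  then show ?case by auto
qed auto

lemma wf_fm_params: "wf_fm L A \<phi> \<Longrightarrow> params \<phi> \<subseteq> Sigma UNIV A"
proof (induction \<phi>)
  case (Eq t u)
  then show ?case by (auto dest: has_sort_params)
next
  case (Rel r ts)
  have "params_trm t \<subseteq> Sigma UNIV A" if t: "t \<in> set ts" for t
    using Rel t by (auto simp: list_all2_conv_all_nth in_set_conv_nth dest!: has_sort_params)
  then show ?case by auto
qed auto

lemma has_sort_change_params:
  "has_sort L A t s \<Longrightarrow> params_trm t \<subseteq> Sigma UNIV B \<Longrightarrow> has_sort L B t s"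
proof (induction t arbitrary: s)
  case (App f ts)
  have "has_sort L B t s'" if "t \<in> set ts" "has_sort L A t s'" for t s'
    using App.IH[OF that] App.prems(2) that by auto
  then show ?case using App.prems(1) by (auto elim!: list.rel_mono_strong)
qed auto

lemma wf_fm_change_params:
  "wf_fm L A \<phi> \<Longrightarrow> params \<phi> \<subseteq> Sigma UNIV B \<Longrightarrow> wf_fm L B \<phi>"
proof (induction \<phi>)
  case (Rel r ts)
  then show ?case by (auto elim!: list.rel_mono_strong intro: has_sort_change_params)
qed (auto intro: has_sort_change_params)

lemma eval_cong: "(\<And>v. v \<in> fv_trm t \<Longrightarrow> e v = e' v) \<Longrightarrow> eval M e t = eval M e' t"
proof (induction t)
  case (App f ts)
  then have "map (eval M e) ts = map (eval M e') ts" by auto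
  then show ?case by (simp only: eval.simps)
qed auto

lemma sat_cong: "(\<And>v. v \<in> fv \<phi> \<Longrightarrow> e v = e' v) \<Longrightarrow> sat M e \<phi> \<longleftrightarrow> sat M e' \<phi>"
proof (induction \<phi> arbitrary: e e')
  case (Eq t u)
  then show ?case using eval_cong[of t e e' M] eval_cong[of u e e' M] by auto
next
  case (Rel r ts)
  have "map (eval M e) ts = map (eval M e') ts" using Rel by (auto intro!: eval_cong)
  then show ?case by (simp only: sat.simps)
next
  case (Neg \<phi>)
  then show ?case by (metis fv.simps(3) sat.simps(3))
next
  case (Conj \<phi> \<psi>)
  have "sat M e \<phi> = sat M e' \<phi>" "sat M e \<psi> = sat M e' \<psi>"
    using Conj.prems by (auto intro!: Conj.IH)
  then show ?case by simp
next
  case (Ex v \<phi>)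
  have "sat M (e(v := a)) \<phi> = sat M (e'(v := a)) \<phi>" for a
    using Ex.prems by (intro Ex.IH) auto
  then show ?case by simp
qed

lemma eval_univ_update [simp]: "eval (M\<lparr>univ := N\<rparr>) e t = eval M e t"
proof (induction t)
  case (App f ts)
  then have "map (eval (M\<lparr>univ := N\<rparr>) e) ts = map (eval M e) ts" by auto
  moreover have "fint (M\<lparr>univ := N\<rparr>) = fint M" by simp
  ultimately show ?case by (simp only: eval.simps)
qed auto

text \<open>Parameters can be traded for variables: the parameter \<open>a\<close> of sort \<open>s\<close> becomes the variable
  with number \<open>\<rho> s a\<close>. This reduces statements on formulas with parameters to formulas of the
  language itself, which are the ones counted by the saturation cardinal.\<close>

primrec unparam_trm :: "('s \<Rightarrow> 'a \<Rightarrow> nat) \<Rightarrow> ('s, 'f, 'a) trm \<Rightarrow> ('s, 'f, 'a) trm" where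
  "unparam_trm \<rho> (Var v) = Var v"
| "unparam_trm \<rho> (Par s a) = Var (s, \<rho> s a)"
| "unparam_trm \<rho> (App f ts) = App f (map (unparam_trm \<rho>) ts)"

primrec unparam :: "('s \<Rightarrow> 'a \<Rightarrow> nat) \<Rightarrow> ('s, 'f, 'r, 'a) fm \<Rightarrow> ('s, 'f, 'r, 'a) fm" where
  "unparam \<rho> (Eq t u) = Eq (unparam_trm \<rho> t) (unparam_trm \<rho> u)"
| "unparam \<rho> (Rel r ts) = Rel r (map (unparam_trm \<rho>) ts)"
| "unparam \<rho> (Neg \<phi>) = Neg (unparam \<rho> \<phi>)"
| "unparam \<rho> (Conj \<phi> \<psi>) = Conj (unparam \<rho> \<phi>) (unparam \<rho> \<psi>)"
| "unparam \<rho> (Ex v \<phi>) = Ex v (unparam \<rho> \<phi>)"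

lemma has_sort_unparam: "has_sort L A t s \<Longrightarrow> has_sort L B (unparam_trm \<rho> t) s"
proof (induction t arbitrary: s)
  case (App f ts)
  then show ?case by (auto simp: list_all2_map1 elim!: list.rel_mono_strong)
qed auto

lemma wf_fm_unparam: "wf_fm L A \<phi> \<Longrightarrow> wf_fm L B (unparam \<rho> \<phi>)"
proof (induction \<phi>)
  case (Rel r ts)
  then show ?case by (auto simp: list_all2_map1 has_sort_unparam elim!: list.rel_mono_strong)
qed (auto intro: has_sort_unparam)

lemma fv_unparam_trm:
  "fv_trm (unparam_trm \<rho> t) \<subseteq> fv_trm t \<union> (\<lambda>(s, a). (s, \<rho> s a)) ` params_trm t"
  by (induction t) fastforce+

lemma fv_unparam: "fv (unparam \<rho> \<phi>) \<subseteq> fv \<phi> \<union> (\<lambda>(s, a). (s, \<rho> s a)) ` params \<phi>"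
proof (induction \<phi>)
  case (Eq t u)
  then show ?case using fv_unparam_trm[of \<rho> t] fv_unparam_trm[of \<rho> u] by fastforce
next
  case (Rel r ts)
  then show ?case using fv_unparam_trm[of \<rho>] by fastforce
qed fastforce+

lemma eval_unparam:
  "(\<And>s a. (s, a) \<in> params_trm t \<Longrightarrow> e (s, \<rho> s a) = a) \<Longrightarrow>
     eval M e (unparam_trm \<rho> t) = eval M e t"
proof (induction t)
  case (App f ts)
  then have "map (eval M e \<circ> unparam_trm \<rho>) ts = map (eval M e) ts" by auto
  then show ?case by (simp only: eval.simps unparam_trm.simps map_map)
qed auto

lemma sat_unparam:
  assumes "\<And>s a. (s, a) \<in> params \<phi> \<Longrightarrow> e (s, \<rho> s a) = a"
    and "\<And>s a. (s, a) \<in> params \<phi> \<Longrightarrow> (s, \<rho> s a) \<notin> bound_vars \<phi>"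
  shows "sat M e (unparam \<rho> \<phi>) \<longleftrightarrow> sat M e \<phi>"
  using assms
proof (induction \<phi> arbitrary: e)
  case (Eq t u)
  then show ?case by (simp add: eval_unparam)
next
  case (Rel r ts)
  have "map (eval M e \<circ> unparam_trm \<rho>) ts = map (eval M e) ts"
    using Rel by (auto intro!: eval_unparam)
  then show ?case by (simp only: sat.simps unparam.simps map_map)
next
  case (Ex v \<phi>)
  have "sat M (e(v := a)) (unparam \<rho> \<phi>) = sat M (e(v := a)) \<phi>" for a
    using Ex.prems by (intro Ex.IH) auto
  then show ?case by simp
qed auto

section \<open>The downward Loewenheim-Skolem theorem\<close>

lemma card_of_Times_ordLeq_infinite':
  "infinite F \<Longrightarrow> |A| \<le>o |F| \<Longrightarrow> |B| \<le>o |F| \<Longrightarrow> |A \<times> B| \<le>o |F|"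
  by (rule card_of_Times_ordLeq_infinite_Field) (auto simp: Field_card_of card_of_card_order_on)

lemma card_of_lists_ordLeq:
  assumes inf: "infinite F" and A: "|A| \<le>o |F|"
  shows "|lists A| \<le>o |F|"
proof -
  have *: "|{xs \<in> lists A. length xs = n}| \<le>o |F|" for n
  proof (induction n)
    case 0
    have "{xs \<in> lists A. length xs = 0} = {[]}" by auto
    then show ?case
      using inf by (metis card_of_ordLeq_infinite finite.emptyI finite_insert ordLeq_total
          card_of_Well_order)
  next
    case (Suc n)
    have "{xs \<in> lists A. length xs = Suc n} \<subseteq>
       (\<lambda>(x, xs). x # xs) ` (A \<times> {xs \<in> lists A. length xs = n})"
      by (auto simp: length_Suc_conv image_iff)
    moreover have "|A \<times> {xs \<in> lists A. length xs = n}| \<le>o |F|"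
      using inf A Suc by (intro card_of_Times_ordLeq_infinite') auto
    ultimately show ?case
      by (meson card_of_image card_of_mono1 ordLeq_transitive)
  qed
  have "|UNIV :: nat set| \<le>o |F|" using inf infinite_iff_card_of_nat by blast
  then have "|\<Union>n\<in>UNIV. {xs \<in> lists A. length xs = n}| \<le>o |F|"
    using inf * by (intro card_of_UNION_ordLeq_infinite) auto
  moreover have "(\<Union>n\<in>UNIV. {xs \<in> lists A. length xs = n}) = lists A" by auto
  ultimately show ?thesis by simp
qed

text \<open>Closing a set under finitary operations does not leave an infinite cardinality bound, as
  the closure is the union of countably many stages.\<close>

lemma closure_under_operations:
  fixes P D :: "'b set" and I :: "'i set" and F :: "'w set" and f :: "'i \<Rightarrow> 'b list \<Rightarrow> 'b"
  assumes inf: "infinite F" and P: "|P| \<le>o |F|" "P \<subseteq> D" and I: "|I| \<le>o |F|"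
    and f: "\<And>i as. f i as \<in> D"
  obtains Z where "P \<subseteq> Z" "Z \<subseteq> D" "|Z| \<le>o |F|" "\<And>i as. i \<in> I \<Longrightarrow> as \<in> lists Z \<Longrightarrow> f i as \<in> Z"
proof -
  define Z where "Z = rec_nat P (\<lambda>_ X. X \<union> (\<lambda>(i, as). f i as) ` (I \<times> lists X))"
  have Z0: "Z 0 = P" and ZS: "Z (Suc n) = Z n \<union> (\<lambda>(i, as). f i as) ` (I \<times> lists (Z n))" for n
    by (auto simp: Z_def)
  have mono: "Z n \<subseteq> Z k" if "n \<le> k" for n k
    using that by (induction rule: dec_induct) (auto simp: ZS)
  have card: "|Z n| \<le>o |F|" for n
  proof (induction n)
    case 0
    then show ?case using P Z0 by simp
  next
    case (Suc n)
    have "|I \<times> lists (Z n)| \<le>o |F|"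
      using inf I card_of_lists_ordLeq[OF inf Suc] by (intro card_of_Times_ordLeq_infinite') auto
    then have "|(\<lambda>(i, as). f i as) ` (I \<times> lists (Z n))| \<le>o |F|"
      using card_of_image ordLeq_transitive by blast
    then show ?case unfolding ZS using inf Suc by (intro card_of_Un_ordLeq_infinite_Field)
      (auto simp: Field_card_of card_of_card_order_on)
  qed
  have "|UNIV :: nat set| \<le>o |F|" using inf infinite_iff_card_of_nat by blast
  then have "|\<Union>n\<in>UNIV. Z n| \<le>o |F|"
    using inf card by (intro card_of_UNION_ordLeq_infinite) auto
  moreover have "Z n \<subseteq> D" for n by (induction n) (use P f in \<open>auto simp: Z0 ZS\<close>)
  moreover have "f i as \<in> (\<Union>n. Z n)" if "i \<in> I" "as \<in> lists (\<Union>n. Z n)" for i as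
  proof -
    from that(2) have "\<exists>n. as \<in> lists (Z n)"
    proof (induction as)
      case (Cons a as)
      then obtain n k where "a \<in> Z n" "as \<in> lists (Z k)" by auto
      then have "a # as \<in> lists (Z (max n k))"
        using mono[of n "max n k"] mono[of k "max n k"] by auto
      then show ?case by blast
    qed auto
    then obtain n where "as \<in> lists (Z n)" ..
    then have "f i as \<in> Z (Suc n)" using that(1) ZS by (auto intro!: rev_image_eqI[of "(i, as)"])
    then show ?thesis by blast
  qed
  moreover have "P \<subseteq> (\<Union>n. Z n)" using Z0 by blast
  ultimately show thesis by (intro that[of "\<Union>n. Z n"]) auto
qed

text \<open>The Tarski-Vaught condition. The elements of \<open>N\<close> enter through the assignment, so that
  the formulas over which it ranges are those of the language itself.\<close>

definition witness_closed ::
  "('s, 'f, 'r) lang \<Rightarrow> ('s, 'f, 'r, 'a) struct \<Rightarrow> ('s \<Rightarrow> 'a set) \<Rightarrow> bool" where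
  "witness_closed L M N \<longleftrightarrow> (\<forall>v. \<forall>\<psi> \<in> formulas L (\<lambda>_. {}). \<forall>e.
     (\<forall>w \<in> fv \<psi> - {v}. e w \<in> N (fst w)) \<longrightarrow> (\<exists>a \<in> univ M (fst v). sat M (e(v := a)) \<psi>) \<longrightarrow>
     (\<exists>a \<in> N (fst v). sat M (e(v := a)) \<psi>))"

lemma witness_closedD:
  assumes "witness_closed L M N" "wf_fm L (\<lambda>_. {}) \<psi>" "\<And>w. w \<in> fv \<psi> - {v} \<Longrightarrow> e w \<in> N (fst w)"
    and "a \<in> univ M (fst v)" "sat M (e(v := a)) \<psi>"
  obtains b where "b \<in> N (fst v)" "sat M (e(v := b)) \<psi>"
  using assms unfolding witness_closed_def formulas_def by blast

lemma witness_closed_sat: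
  assumes N: "\<And>s. N s \<subseteq> univ M s" "witness_closed L M N"
  shows "wf_fm L (\<lambda>_. {}) \<phi> \<Longrightarrow> (\<And>v. v \<in> fv \<phi> \<Longrightarrow> e v \<in> N (fst v)) \<Longrightarrow>
    sat (M\<lparr>univ := N\<rparr>) e \<phi> \<longleftrightarrow> sat M e \<phi>"
proof (induction \<phi> arbitrary: e)
  case (Rel r ts)
  have "map (eval (M\<lparr>univ := N\<rparr>) e) ts = map (eval M e) ts" by simp
  moreover have "rint (M\<lparr>univ := N\<rparr>) = rint M" by simp
  ultimately show ?case by (simp only: sat.simps)
next
  case (Ex v \<phi>)
  have *: "sat (M\<lparr>univ := N\<rparr>) (e(v := a)) \<phi> = sat M (e(v := a)) \<phi>" if "a \<in> N (fst v)" for a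
    using Ex.prems that by (intro Ex.IH) auto
  show ?case
  proof
    assume "sat (M\<lparr>univ := N\<rparr>) e (Ex v \<phi>)"
    then show "sat M e (Ex v \<phi>)" using * N(1) by auto
  next
    assume "sat M e (Ex v \<phi>)"
    then obtain a where a: "a \<in> univ M (fst v)" "sat M (e(v := a)) \<phi>" by auto
    obtain b where "b \<in> N (fst v)" "sat M (e(v := b)) \<phi>"
    proof (rule witness_closedD[OF N(2) _ _ a])
      show "wf_fm L (\<lambda>_. {}) \<phi>" using Ex.prems by simp
    qed (use Ex.prems in auto)
    then show "sat (M\<lparr>univ := N\<rparr>) e (Ex v \<phi>)" using * by auto
  qed
qed auto

text \<open>The value of a function \<open>f\<close> at arguments in \<open>N\<close> is the only witness of \<open>\<exists>v. v = f(\<dots>)\<close>, so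
  \<open>N\<close> is closed under \<open>f\<close>. A sentence with parameters from \<open>N\<close> has the truth value of a formula
  without parameters under an assignment into \<open>N\<close>.\<close>

lemma witness_closed_imp_elementary_sub:
  assumes M: "is_structure L M" and N: "\<And>s. N s \<subseteq> univ M s" "witness_closed L M N"
  shows "elementary_sub L M N"
  unfolding elementary_sub_def
proof (intro conjI allI ballI)
  show "N s \<subseteq> univ M s" for s by (rule N)
  show "is_structure L (M\<lparr>univ := N\<rparr>)"
    unfolding is_structure_def
  proof (intro conjI allI ballI impI)
    fix s
    obtain a where a: "a \<in> univ M s" using M unfolding is_structure_def by blast
    let ?\<phi> = "Eq (Var (s, 0)) (Var (s, 0)) :: ('a, 'b, 'c, 'd) fm"
    obtain b where "b \<in> N (fst (s, 0::nat))"
      by (rule witness_closedD[OF N(2), of ?\<phi> "(s, 0)" undefined a]) (use a in auto)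
    then show "univ (M\<lparr>univ := N\<rparr>) s \<noteq> {}" by auto
  next
    fix f as
    assume f: "f \<in> funs L"
      and as: "list_all2 (\<lambda>a s. a \<in> univ (M\<lparr>univ := N\<rparr>) s) as (fst (fun_type L f))"
    define ss s where "ss = fst (fun_type L f)" and "s = snd (fun_type L f)"
    define n where "n = length ss"
    have len: "length as = n" and as': "\<And>i. i < n \<Longrightarrow> as ! i \<in> N (ss ! i)"
      using as by (auto simp: list_all2_conv_all_nth ss_def n_def)
    have inM: "fint M f as \<in> univ M s"
    proof -
      have "list_all2 (\<lambda>a s. a \<in> univ M s) as (fst (fun_type L f))"
        using as N(1) by (auto elim!: list_all2_mono)
      then show ?thesis using M f unfolding is_structure_def s_def by blast
    qed
    \<comment> \<open>The arguments are named by variables with pairwise distinct numbers, so that equal sorts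
        cause no clash; the number \<open>n\<close> is free for the value.\<close>
    define ts :: "('a, 'b, 'd) trm list" where "ts = map (\<lambda>i. Var (ss ! i, i)) [0..<n]"
    let ?\<phi> = "Eq (Var (s, n)) (App f ts) :: ('a, 'b, 'c, 'd) fm"
    let ?e = "\<lambda>w. as ! snd w"
    have wf: "wf_fm L (\<lambda>_. {}) ?\<phi>"
      using f by (auto simp: s_def ts_def list_all2_conv_all_nth n_def simp flip: ss_def)
    have ev: "map (eval M (?e((s, n) := b))) ts = as" for b
      using len by (auto simp: ts_def intro!: nth_equalityI)
    obtain b where b: "b \<in> N (fst (s, n))" "sat M (?e((s, n) := b)) ?\<phi>"
    proof (rule witness_closedD[OF N(2) wf, of "(s, n)" ?e "fint M f as"])
      show "?e w \<in> N (fst w)" if "w \<in> fv ?\<phi> - {(s, n)}" for w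
        using that as' by (auto simp: ts_def)
    qed (use inM ev in auto)
    then show "fint (M\<lparr>univ := N\<rparr>) f as \<in> univ (M\<lparr>univ := N\<rparr>) (snd (fun_type L f))"
      using ev[of b] by (simp add: s_def)
  qed
next
  fix \<phi> :: "('a, 'b, 'c, 'd) fm"
  assume "\<phi> \<in> sentences L N"
  then have wf: "wf_fm L N \<phi>" and fv: "fv \<phi> = {}" by (auto simp: sentences_def formulas_def)
  \<comment> \<open>Fresh variable numbers for the parameters: a numbering of them, shifted beyond the bound
      variables.\<close>
  obtain h :: "'a \<times> 'd \<Rightarrow> nat" where h: "inj_on h (params \<phi>)"
    using finite_imp_inj_to_nat_seg[OF finite_params[of \<phi>]] by auto
  obtain K where K: "\<And>v. v \<in> bound_vars \<phi> \<Longrightarrow> snd v < K"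
    using finite_bound_vars[of \<phi>] finite_nat_set_iff_bounded[of "snd ` bound_vars \<phi>"] by auto
  define \<rho> where "\<rho> s a = K + h (s, a)" for s a
  define e where "e w = (THE a. (fst w, a) \<in> params \<phi> \<and> \<rho> (fst w) a = snd w)" for w
  have e: "e (s, \<rho> s a) = a" if "(s, a) \<in> params \<phi>" for s a
    unfolding e_def using h that by (auto simp: \<rho>_def inj_on_def intro!: the_equality)
  have fresh: "(s, \<rho> s a) \<notin> bound_vars \<phi>" for s a
    using K[of "(s, \<rho> s a)"] by (auto simp: \<rho>_def)
  have "sat (M\<lparr>univ := N\<rparr>) e (unparam \<rho> \<phi>) \<longleftrightarrow> sat M e (unparam \<rho> \<phi>)"
  proof (rule witness_closed_sat[OF N])
    show "wf_fm L (\<lambda>_. {}) (unparam \<rho> \<phi>)" using wf by (rule wf_fm_unparam)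
    show "e v \<in> N (fst v)" if "v \<in> fv (unparam \<rho> \<phi>)" for v
      using that fv_unparam[of \<rho> \<phi>] fv e wf_fm_params[OF wf] by fastforce
  qed
  then have "sat (M\<lparr>univ := N\<rparr>) e \<phi> \<longleftrightarrow> sat M e \<phi>"
    using sat_unparam[of \<phi> e \<rho>] e fresh by blast
  then show "holds (M\<lparr>univ := N\<rparr>) \<phi> \<longleftrightarrow> holds M \<phi>"
    unfolding holds_def using sat_cong[of \<phi> e "\<lambda>_. undefined"] fv by auto
qed

text \<open>The equations \<open>v = v\<close> alone show that there are at least as many formulas as variables, so
  the number of formulas bounds the number of sorts and is infinite.\<close>

lemma card_of_vars_ordLeq_formulas:
  "|UNIV :: 's var set| \<le>o |formulas L (\<lambda>_. {}) :: ('s, 'f, 'r, 'a) fm set|"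
proof -
  have "inj (\<lambda>v. Eq (Var v) (Var v) :: ('s, 'f, 'r, 'a) fm)" by (auto simp: inj_on_def)
  then show ?thesis
    unfolding card_of_ordLeq[symmetric] by (auto simp: formulas_def)
qed

lemma infinite_formulas: "infinite (formulas L (\<lambda>_. {}) :: ('s, 'f, 'r, 'a) fm set)"
proof -
  have "infinite (UNIV :: 's var set)" by (simp add: finite_prod)
  then show ?thesis using card_of_vars_ordLeq_formulas card_of_ordLeq_infinite by blast
qed

text \<open>\<open>N\<close> is the closure of \<open>P\<close> under Skolem functions. These are indexed by a formula, the
  variable to be witnessed and the list of variables that receive the arguments, so there are no
  more of them than formulas. Elements are paired with their sorts because the same element may
  belong to several sorts.\<close>

theorem downward_Loewenheim_Skolem:
  fixes L :: "('s, 'f, 'r) lang" and M :: "('s, 'f, 'r, 'a) struct"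
  assumes M: "is_structure L M" and P: "P \<subseteq> Sigma UNIV (univ M)"
    and cP: "|P| \<le>o |formulas L (\<lambda>_. {}) :: ('s, 'f, 'r, 'a) fm set|"
  obtains N where "elementary_sub L M N" "P \<subseteq> Sigma UNIV N"
    "|Sigma UNIV N| \<le>o |formulas L (\<lambda>_. {}) :: ('s, 'f, 'r, 'a) fm set|"
proof -
  define F :: "('s, 'f, 'r, 'a) fm set" where "F = formulas L (\<lambda>_. {})"
  define asg :: "'s var list \<Rightarrow> ('s \<times> 'a) list \<Rightarrow> 's var \<Rightarrow> 'a"
    where "asg vs as w = the (map_of (zip vs (map snd as)) w)" for vs as w
  define good where "good v \<psi> vs as a \<longleftrightarrow> a \<in> univ M (fst v) \<and>
     ((\<exists>b \<in> univ M (fst v). sat M ((asg vs as)(v := b)) \<psi>) \<longrightarrow> sat M ((asg vs as)(v := a)) \<psi>)"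
    for v and \<psi> :: "('s, 'f, 'r, 'a) fm" and vs as a
  define sk where "sk = (\<lambda>(v, \<psi>, vs) as. (fst v, SOME a. good v \<psi> vs as a))"
  have good: "good v \<psi> vs as (SOME a. good v \<psi> vs as a)" for v \<psi> vs as
  proof (rule someI_ex)
    obtain a where "a \<in> univ M (fst v)" using M unfolding is_structure_def by blast
    then show "\<exists>a. good v \<psi> vs as a" unfolding good_def by blast
  qed
  have inf: "infinite F" unfolding F_def by (rule infinite_formulas)
  have V: "|UNIV :: 's var set| \<le>o |F|" unfolding F_def by (rule card_of_vars_ordLeq_formulas)
  have I: "|(UNIV :: 's var set) \<times> F \<times> lists (UNIV :: 's var set)| \<le>o |F|"
    using inf V card_of_lists_ordLeq[OF inf V]
    by (intro card_of_Times_ordLeq_infinite') (auto intro: ordLeq_refl card_of_Card_order)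
  have D: "sk i as \<in> Sigma UNIV (univ M)" for i as
    using good by (auto simp: sk_def good_def split: prod.splits)
  obtain Z where Z: "P \<subseteq> Z" "Z \<subseteq> Sigma UNIV (univ M)" "|Z| \<le>o |F|"
    "\<And>i as. i \<in> UNIV \<times> F \<times> lists UNIV \<Longrightarrow> as \<in> lists Z \<Longrightarrow> sk i as \<in> Z"
    using closure_under_operations[OF inf cP[folded F_def] P I, of sk] D by metis
  define N where "N s = {a. (s, a) \<in> Z}" for s
  have NZ: "Sigma UNIV N = Z" by (auto simp: N_def)
  have "witness_closed L M N"
    unfolding witness_closed_def F_def[symmetric]
  proof (intro allI ballI impI)
    fix v \<psi> e
    assume \<psi>: "\<psi> \<in> F" and e: "\<forall>w \<in> fv \<psi> - {v}. e w \<in> N (fst w)"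
      and ex: "\<exists>a \<in> univ M (fst v). sat M (e(v := a)) \<psi>"
    obtain vs where vs: "set vs = fv \<psi> - {v}" using finite_list finite_fv by (metis finite_Diff)
    define as where "as = map (\<lambda>w. (fst w, e w)) vs"
    have "map snd as = map e vs" by (simp add: as_def)
    then have "asg vs as w = e w" if "w \<in> fv \<psi> - {v}" for w
      using that vs by (simp add: asg_def map_of_zip_map)
    then have same: "sat M ((asg vs as)(v := a)) \<psi> = sat M (e(v := a)) \<psi>" for a
      by (intro sat_cong) auto
    have "as \<in> lists Z" using e vs by (auto simp: as_def N_def)
    then have "sk (v, \<psi>, vs) as \<in> Z" using \<psi> by (intro Z(4)) auto
    moreover have "sat M (e(v := snd (sk (v, \<psi>, vs) as))) \<psi>"
      using good[of v \<psi> vs as] ex by (auto simp: sk_def good_def same)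
    ultimately show "\<exists>a \<in> N (fst v). sat M (e(v := a)) \<psi>"
      by (auto simp: N_def sk_def)
  qed
  moreover have "N s \<subseteq> univ M s" for s using Z(2) by (auto simp: N_def)
  ultimately have "elementary_sub L M N" using M by (intro witness_closed_imp_elementary_sub)
  then show thesis using Z NZ F_def that by metis
qed

section \<open>Definable sets and types\<close>

lemma Lx_subset: "X \<in> Lx L M s A \<Longrightarrow> X \<subseteq> univ M s"
  by (auto simp: Lx_def solutions_def)

lemma Lx_univ: "univ M s \<in> Lx L M s A"
proof -
  let ?\<phi> = "Eq (Var (xvar s)) (Var (xvar s))"
  have "univ M s = solutions M s ?\<phi>" by (auto simp: solutions_def)
  moreover have "?\<phi> \<in> xformulas L s A" by (auto simp: xformulas_def formulas_def)
  ultimately show ?thesis unfolding Lx_def by blast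
qed

lemma Lx_Diff: "X \<in> Lx L M s A \<Longrightarrow> univ M s - X \<in> Lx L M s A"
proof -
  assume "X \<in> Lx L M s A"
  then obtain \<phi> where \<phi>: "X = solutions M s \<phi>" "\<phi> \<in> xformulas L s A" by (auto simp: Lx_def)
  have "univ M s - X = solutions M s (Neg \<phi>)" by (auto simp: solutions_def \<phi>)
  moreover have "Neg \<phi> \<in> xformulas L s A" using \<phi> by (auto simp: xformulas_def formulas_def)
  ultimately show ?thesis unfolding Lx_def by blast
qed

lemma Lx_Int: "X \<in> Lx L M s A \<Longrightarrow> Y \<in> Lx L M s A \<Longrightarrow> X \<inter> Y \<in> Lx L M s A"
proof -
  assume "X \<in> Lx L M s A" "Y \<in> Lx L M s A"
  then obtain \<phi> \<psi> where \<phi>: "X = solutions M s \<phi>" "\<phi> \<in> xformulas L s A"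
    and \<psi>: "Y = solutions M s \<psi>" "\<psi> \<in> xformulas L s A" by (auto simp: Lx_def)
  have "X \<inter> Y = solutions M s (Conj \<phi> \<psi>)" by (auto simp: solutions_def \<phi> \<psi>)
  moreover have "Conj \<phi> \<psi> \<in> xformulas L s A"
    using \<phi> \<psi> by (auto simp: xformulas_def formulas_def)
  ultimately show ?thesis unfolding Lx_def by blast
qed

lemma Lx_Un:
  assumes "X \<in> Lx L M s A" "Y \<in> Lx L M s A" shows "X \<union> Y \<in> Lx L M s A"
proof -
  have "X \<union> Y = univ M s - ((univ M s - X) \<inter> (univ M s - Y))"
    using assms[THEN Lx_subset] by auto
  then show ?thesis using assms by (simp add: Lx_Diff Lx_Int)
qed

lemma Lx_empty: "{} \<in> Lx L M s A"
  using Lx_Diff[OF Lx_univ] by (metis Diff_cancel)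

lemma Lx_UN: "finite F \<Longrightarrow> F \<subseteq> Lx L M s A \<Longrightarrow> \<Union>F \<in> Lx L M s A"
  by (induction F rule: finite_induct) (auto intro: Lx_Un Lx_empty)

lemma Lx_singleton:
  assumes "a \<in> A s" "a \<in> univ M s" shows "{a} \<in> Lx L M s A"
proof -
  let ?\<phi> = "Eq (Var (xvar s)) (Par s a)"
  have "{a} = solutions M s ?\<phi>" using assms by (auto simp: solutions_def)
  moreover have "?\<phi> \<in> xformulas L s A"
    using assms by (auto simp: xformulas_def formulas_def xvar_def)
  ultimately show ?thesis unfolding Lx_def by blast
qed

lemma Lx_finite: "finite F \<Longrightarrow> F \<subseteq> A s \<Longrightarrow> F \<subseteq> univ M s \<Longrightarrow> F \<in> Lx L M s A"
proof -
  assume F: "finite F" "F \<subseteq> A s" "F \<subseteq> univ M s"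
  have "\<Union>((\<lambda>a. {a}) ` F) \<in> Lx L M s A"
    using F by (intro Lx_UN) (auto intro: Lx_singleton)
  then show ?thesis by simp
qed

lemma xformulas_mono:
  assumes "\<And>s. A s \<subseteq> B s" shows "xformulas L s A \<subseteq> xformulas L s B"
proof -
  have "wf_fm L B \<phi>" if "wf_fm L A \<phi>" for \<phi> :: "('a, 'c, 'd, 'b) fm"
    using wf_fm_params[OF that] assms by (intro wf_fm_change_params[OF that]) blast
  then show ?thesis by (auto simp: xformulas_def formulas_def)
qed

lemma Lx_mono: "(\<And>s. A s \<subseteq> B s) \<Longrightarrow> Lx L M s A \<subseteq> Lx L M s B"
  unfolding Lx_def by (intro image_mono xformulas_mono)

lemma tp_in_types: "a \<in> univ M s \<Longrightarrow> tp L M s A a \<in> types L M s A"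
  unfolding types_def tp_def by (auto intro: Lx_Diff)

lemma type_subset: "p \<in> types L M s A \<Longrightarrow> p \<subseteq> Lx L M s A"
  by (simp add: types_def)

lemma type_satisfiable:
  "p \<in> types L M s A \<Longrightarrow> finite F \<Longrightarrow> F \<subseteq> p \<Longrightarrow> \<exists>a \<in> univ M s. \<forall>X \<in> F. a \<in> X"
  by (simp add: types_def)

lemma type_complement:
  assumes p: "p \<in> types L M s A" and X: "X \<in> Lx L M s A"
  shows "univ M s - X \<in> p \<longleftrightarrow> X \<notin> p"
  using type_satisfiable[OF p, of "{X, univ M s - X}"] p X unfolding types_def by auto

lemma type_upward:
  assumes p: "p \<in> types L M s A" and F: "finite F" "F \<subseteq> p"
    and X: "X \<in> Lx L M s A" "univ M s \<inter> \<Inter>F \<subseteq> X"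
  shows "X \<in> p"
proof (rule ccontr)
  assume "X \<notin> p"
  then have "insert (univ M s - X) F \<subseteq> p" using type_complement[OF p X(1)] F by auto
  from type_satisfiable[OF p _ this] F X show False by auto
qed

lemma type_univ: "p \<in> types L M s A \<Longrightarrow> univ M s \<in> p"
  by (rule type_upward[of _ _ _ _ _ "{}"]) (auto intro: Lx_univ)

lemma type_Int_iff:
  assumes "p \<in> types L M s A" "X \<in> Lx L M s A" "Y \<in> Lx L M s A"
  shows "X \<inter> Y \<in> p \<longleftrightarrow> X \<in> p \<and> Y \<in> p"
proof (intro iffI conjI)
  assume XY: "X \<inter> Y \<in> p"
  show "X \<in> p"
    by (rule type_upward[OF assms(1), of "{X \<inter> Y}"]) (use XY assms(2) in auto)
  show "Y \<in> p"
    by (rule type_upward[OF assms(1), of "{X \<inter> Y}"]) (use XY assms(3) in auto)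
next
  assume "X \<in> p \<and> Y \<in> p"
  then show "X \<inter> Y \<in> p"
    using Lx_Int[OF assms(2,3)] by (intro type_upward[OF assms(1), of "{X, Y}"]) auto
qed

lemma type_Union_iff:
  assumes p: "p \<in> types L M s A" and F: "finite F" "F \<subseteq> Lx L M s A"
  shows "\<Union>F \<in> p \<longleftrightarrow> (\<exists>X \<in> F. X \<in> p)"
proof
  assume U: "\<Union>F \<in> p"
  show "\<exists>X \<in> F. X \<in> p"
  proof (rule ccontr)
    assume "\<not> ?thesis"
    then have "insert (\<Union>F) ((\<lambda>X. univ M s - X) ` F) \<subseteq> p"
      using U F type_complement[OF p] by blast
    from type_satisfiable[OF p _ this] F show False by auto
  qed
next
  assume "\<exists>X \<in> F. X \<in> p"
  then obtain X where "X \<in> F" "X \<in> p" by blast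
  then show "\<Union>F \<in> p" using Lx_UN[OF F] by (intro type_upward[OF p, of "{X}"]) auto
qed

text \<open>Distinct types are incomparable by completeness, so \<open>p\<close> contains for each \<open>q\<close> a set
  that is not in \<open>q\<close>; the intersection of these finitely many sets is again in \<open>p\<close>.\<close>

lemma types_separated:
  assumes p: "p \<in> types L M s A" and Q: "finite Q" "Q \<subseteq> types L M s A" "p \<notin> Q"
  obtains X where "X \<in> p" "\<forall>q \<in> Q. X \<notin> q"
proof -
  have "\<exists>X \<in> p. X \<notin> q" if "q \<in> Q" for q
  proof (rule ccontr)
    assume "\<not> ?thesis"
    then have "p \<subseteq> q" by auto
    moreover have q: "q \<in> types L M s A" using that Q by auto
    ultimately have "p = q"
      using type_complement[OF p] type_complement[OF q] type_subset[OF q] by blast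
    with that Q show False by auto
  qed
  then obtain f where f: "\<And>q. q \<in> Q \<Longrightarrow> f q \<in> p" "\<And>q. q \<in> Q \<Longrightarrow> f q \<notin> q" by metis
  define X where "X = univ M s - \<Union>((\<lambda>q. univ M s - f q) ` Q)"
  have sub: "(\<lambda>q. univ M s - f q) ` Q \<subseteq> Lx L M s A"
    using f type_subset[OF p] by (auto intro: Lx_Diff)
  have "X \<in> p"
  proof (rule type_upward[OF p])
    show "finite (f ` Q)" "f ` Q \<subseteq> p" using Q(1) f by auto
    show "X \<in> Lx L M s A" unfolding X_def using Q(1) sub by (intro Lx_Diff Lx_UN) auto
    show "univ M s \<inter> \<Inter>(f ` Q) \<subseteq> X" by (auto simp: X_def)
  qed
  moreover have "\<forall>q \<in> Q. X \<notin> q"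
  proof (intro ballI notI)
    fix q assume that: "q \<in> Q" and X: "X \<in> q"
    have q: "q \<in> types L M s A" using that Q by auto
    have "univ M s \<inter> \<Inter>{X} \<subseteq> f q" using that by (auto simp: X_def)
    moreover have "f q \<in> Lx L M s A" using f(1)[OF that] type_subset[OF p] by blast
    ultimately have "f q \<in> q" using X by (intro type_upward[OF q, of "{X}"]) auto
    with f that show False by blast
  qed
  ultimately show thesis by (rule that)
qed

section \<open>The type space and its Borel measures\<close>

definition clopen_of ::
  "('s, 'f, 'r) lang \<Rightarrow> ('s, 'f, 'r, 'a) struct \<Rightarrow> 's \<Rightarrow> ('s \<Rightarrow> 'a set) \<Rightarrow> 'a set \<Rightarrow> 'a set set set"
  where
  "clopen_of L M s A X = {p \<in> types L M s A. X \<in> p}"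

lemma type_topology_clopen_of:
  "type_topology L M s A = topology_generated_by (clopen_of L M s A ` Lx L M s A)"
  by (simp add: type_topology_def clopen_of_def[abs_def])

lemma openin_clopen_of: "X \<in> Lx L M s A \<Longrightarrow> openin (type_topology L M s A) (clopen_of L M s A X)"
  unfolding type_topology_clopen_of by (intro topology_generated_by_Basis) auto

lemma topspace_type_topology: "topspace (type_topology L M s A) = types L M s A"
  unfolding type_topology_clopen_of topology_generated_by_topspace
  using Lx_univ type_univ by (fastforce simp: clopen_of_def)

lemma open_contains_clopen_of:
  assumes "openin (type_topology L M s A) U" "p \<in> U"
  obtains X where "X \<in> Lx L M s A" "p \<in> clopen_of L M s A X" "clopen_of L M s A X \<subseteq> U"
proof -
  have "generate_topology_on (clopen_of L M s A ` Lx L M s A) U"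
    using assms(1) by (simp add: type_topology_clopen_of openin_topology_generated_by_iff)
  then have "\<forall>p \<in> U. \<exists>X \<in> Lx L M s A. p \<in> clopen_of L M s A X \<and> clopen_of L M s A X \<subseteq> U"
  proof induction
    case (Int a b)
    show ?case
    proof
      fix p assume "p \<in> a \<inter> b"
      then have p: "p \<in> a" "p \<in> b" by auto
      from bspec[OF Int.IH(1) p(1)] obtain X where X: "X \<in> Lx L M s A"
        "p \<in> clopen_of L M s A X \<and> clopen_of L M s A X \<subseteq> a" by (rule bexE)
      from bspec[OF Int.IH(2) p(2)] obtain Y where Y: "Y \<in> Lx L M s A"
        "p \<in> clopen_of L M s A Y \<and> clopen_of L M s A Y \<subseteq> b" by (rule bexE)
      have "clopen_of L M s A (X \<inter> Y) = clopen_of L M s A X \<inter> clopen_of L M s A Y"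
        using X(1) Y(1) by (auto simp: clopen_of_def type_Int_iff)
      then show "\<exists>X \<in> Lx L M s A. p \<in> clopen_of L M s A X \<and> clopen_of L M s A X \<subseteq> a \<inter> b"
        using X Y by (intro bexI[of _ "X \<inter> Y"]) (auto intro: Lx_Int)
    qed
  next
    case (UN K)
    show ?case
    proof
      fix p assume "p \<in> \<Union>K"
      then obtain k where k: "k \<in> K" "p \<in> k" by blast
      from bspec[OF UN.IH[OF k(1)] k(2)] obtain X where X: "X \<in> Lx L M s A"
        "p \<in> clopen_of L M s A X \<and> clopen_of L M s A X \<subseteq> k" by (rule bexE)
      show "\<exists>X \<in> Lx L M s A. p \<in> clopen_of L M s A X \<and> clopen_of L M s A X \<subseteq> \<Union>K"
        by (rule bexI[OF _ X(1)]) (use X(2) k(1) in auto)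
    qed
  qed auto
  from bspec[OF this assms(2)] obtain X where X: "X \<in> Lx L M s A"
    "p \<in> clopen_of L M s A X \<and> clopen_of L M s A X \<subseteq> U" by (rule bexE)
  show thesis by (rule that[OF X(1)]) (use X(2) in simp_all)
qed

text \<open>The clopen sets form a base closed under finite unions, so a finite subcover of \<open>K\<close> by
  clopen subsets of \<open>U\<close> can be merged into one.\<close>

lemma compact_open_clopen_between:
  assumes K: "compactin (type_topology L M s A) K" and U: "openin (type_topology L M s A) U"
    and "K \<subseteq> U"
  obtains X where "X \<in> Lx L M s A" "K \<subseteq> clopen_of L M s A X" "clopen_of L M s A X \<subseteq> U"
proof -
  define \<C> where "\<C> = {X \<in> Lx L M s A. clopen_of L M s A X \<subseteq> U}"
  have "K \<subseteq> \<Union>(clopen_of L M s A ` \<C>)"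
  proof
    fix p assume "p \<in> K"
    then have "p \<in> U" using assms(3) by blast
    then obtain X where "X \<in> Lx L M s A" "p \<in> clopen_of L M s A X" "clopen_of L M s A X \<subseteq> U"
      by (rule open_contains_clopen_of[OF U])
    then show "p \<in> \<Union>(clopen_of L M s A ` \<C>)" by (auto simp: \<C>_def)
  qed
  moreover have "\<forall>C \<in> clopen_of L M s A ` \<C>. openin (type_topology L M s A) C"
    by (auto simp: \<C>_def intro: openin_clopen_of)
  ultimately have "\<exists>\<F>. finite \<F> \<and> \<F> \<subseteq> clopen_of L M s A ` \<C> \<and> K \<subseteq> \<Union>\<F>"
    using K unfolding compactin_def by simp
  then obtain \<F> where \<F>: "finite \<F>" "\<F> \<subseteq> clopen_of L M s A ` \<C>" "K \<subseteq> \<Union>\<F>"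
    by (elim exE conjE)
  from finite_subset_image[OF \<F>(1,2)] obtain F
    where F: "F \<subseteq> \<C>" "finite F" "\<F> = clopen_of L M s A ` F" by (elim exE conjE)
  have sub: "F \<subseteq> Lx L M s A" using F by (auto simp: \<C>_def)
  have "clopen_of L M s A (\<Union>F) = \<Union>\<F>"
    using type_Union_iff[OF _ F(2) sub] by (auto simp: clopen_of_def F(3))
  moreover have "\<Union>\<F> \<subseteq> U" using F(1,3) unfolding \<C>_def by blast
  ultimately show thesis using \<F>(3) by (intro that[OF Lx_UN[OF F(2) sub]]) auto
qed

lemma openin_compl_finite:
  assumes Q: "finite Q" "Q \<subseteq> types L M s A"
  shows "openin (type_topology L M s A) (types L M s A - Q)"
proof (subst openin_subopen, intro ballI)
  fix p assume p: "p \<in> types L M s A - Q"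
  from p have p': "p \<in> types L M s A" "p \<notin> Q" by auto
  obtain X where X: "X \<in> p" "\<forall>q \<in> Q. X \<notin> q"
    by (rule types_separated[OF p'(1) Q p'(2)])
  have "X \<in> Lx L M s A" by (rule subsetD[OF type_subset[OF p'(1)] X(1)])
  then show "\<exists>T. openin (type_topology L M s A) T \<and> p \<in> T \<and> T \<subseteq> types L M s A - Q"
    using X p by (intro exI[of _ "clopen_of L M s A X"] conjI openin_clopen_of)
      (auto simp: clopen_of_def)
qed

lemma space_type_borel [simp]: "space (type_borel L M s A) = types L M s A"
  and sets_type_borel:
    "sets (type_borel L M s A) = sigma_sets (types L M s A) {U. openin (type_topology L M s A) U}"
proof -
  have "{U. openin (type_topology L M s A) U} \<subseteq> Pow (types L M s A)"
    using openin_subset topspace_type_topology by fastforce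
  then show "space (type_borel L M s A) = types L M s A"
    "sets (type_borel L M s A) = sigma_sets (types L M s A) {U. openin (type_topology L M s A) U}"
    by (simp_all add: type_borel_def space_measure_of sets_measure_of)
qed

lemma openin_type_borel: "openin (type_topology L M s A) U \<Longrightarrow> U \<in> sets (type_borel L M s A)"
  by (simp add: sets_type_borel)

lemma finite_in_type_borel:
  assumes "finite Q" "Q \<subseteq> types L M s A" shows "Q \<in> sets (type_borel L M s A)"
proof -
  have "space (type_borel L M s A) - (types L M s A - Q) \<in> sets (type_borel L M s A)"
    by (intro sets.Diff sets.top openin_type_borel openin_compl_finite assms)
  moreover have "space (type_borel L M s A) - (types L M s A - Q) = Q" using assms by auto
  ultimately show ?thesis by simp
qed

text \<open>A regular measure is determined on open sets by compact subsets, and a compact subset of an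
  open set is covered by a clopen set within it. So the values on clopen sets decide everything.\<close>

lemma regular_extension_unique:
  assumes m: "sets m = sets (type_borel L M s A)" "finite_measure m"
      "regular_measure (type_topology L M s A) m"
    and m': "sets m' = sets (type_borel L M s A)" "finite_measure m'"
      "regular_measure (type_topology L M s A) m'"
    and eq: "\<And>X. X \<in> Lx L M s A \<Longrightarrow>
      measure m (clopen_of L M s A X) = measure m' (clopen_of L M s A X)"
  shows "m = m'"
proof -
  have le: "emeasure m1 U \<le> emeasure m2 U"
    if m1: "sets m1 = sets (type_borel L M s A)" "finite_measure m1"
        "regular_measure (type_topology L M s A) m1"
      and m2: "sets m2 = sets (type_borel L M s A)" "finite_measure m2"
      and eq: "\<And>X. X \<in> Lx L M s A \<Longrightarrow>
        measure m1 (clopen_of L M s A X) = measure m2 (clopen_of L M s A X)"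
      and U: "openin (type_topology L M s A) U" for m1 m2 U
  proof -
    have "U \<in> sets m1" using openin_type_borel[OF U] m1(1) by simp
    then have "emeasure m1 U =
        (SUP K \<in> {K. compactin (type_topology L M s A) K \<and> K \<subseteq> U}. emeasure m1 K)"
      by (rule conjunct2[OF bspec[OF m1(3)[unfolded regular_measure_def]]])
    also have "\<dots> \<le> emeasure m2 U"
    proof (rule SUP_least, clarify)
      fix K assume K: "compactin (type_topology L M s A) K" "K \<subseteq> U"
      obtain X where X: "X \<in> Lx L M s A" "K \<subseteq> clopen_of L M s A X" "clopen_of L M s A X \<subseteq> U"
        by (rule compact_open_clopen_between[OF K(1) U K(2)])
      have C: "clopen_of L M s A X \<in> sets (type_borel L M s A)"
        by (intro openin_type_borel openin_clopen_of X(1))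
      have "emeasure m1 K \<le> emeasure m1 (clopen_of L M s A X)"
        using X C m1 by (intro emeasure_mono) auto
      also have "\<dots> = emeasure m2 (clopen_of L M s A X)"
        using eq[OF X(1)] m1 m2 by (simp add: finite_measure.emeasure_eq_measure)
      also have "\<dots> \<le> emeasure m2 U"
        using X(3) openin_type_borel[OF U] m2(1) by (intro emeasure_mono) auto
      finally show "emeasure m1 K \<le> emeasure m2 U" .
    qed
    finally show ?thesis .
  qed
  let ?E = "{U. openin (type_topology L M s A) U}"
  show ?thesis
  proof (rule measure_eqI_generator_eq[of ?E "types L M s A" _ _ "\<lambda>_. types L M s A"])
    show "Int_stable ?E" by (auto simp: Int_stable_def)
    show "?E \<subseteq> Pow (types L M s A)" using openin_subset topspace_type_topology by fastforce
    show "emeasure m U = emeasure m' U" if "U \<in> ?E" for U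
      using that le[OF m m'(1,2) eq] le[OF m' m(1,2) eq[symmetric]] by (auto intro: antisym)
    show "range (\<lambda>_. types L M s A) \<subseteq> ?E"
      using openin_topspace[of "type_topology L M s A"] by (auto simp: topspace_type_topology)
    show "emeasure m (types L M s A) \<noteq> \<infinity>" using m(2) by (simp add: finite_measure.emeasure_finite)
  qed (auto simp: m m' sets_type_borel)
qed

section \<open>Finitely atomic measures\<close>

text \<open>\<open>\<nu>\<close> is the combination of the Dirac measures at the points of \<open>S\<close> with weights \<open>w\<close>. The
  base \<open>A\<close> varies, as the same atoms serve for the restrictions of a measure to submodels.\<close>

definition atomic ::
  "('s, 'f, 'r) lang \<Rightarrow> ('s, 'f, 'r, 'a) struct \<Rightarrow> 's \<Rightarrow> ('s \<Rightarrow> 'a set) \<Rightarrow> 'a set \<Rightarrow> ('a \<Rightarrow> real)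
    \<Rightarrow> ('a set \<Rightarrow> real) \<Rightarrow> bool" where
  "atomic L M s A S w \<nu> \<longleftrightarrow> finite S \<and> S \<subseteq> univ M s \<and> (\<forall>a \<in> S. 0 < w a) \<and> sum w S = 1 \<and>
     (\<forall>X \<in> Lx L M s A. \<nu> X = sum w (S \<inter> X))"

lemma atomic_restrict:
  assumes "atomic L M s B S w \<nu>" "\<And>s. A s \<subseteq> B s"
  shows "atomic L M s A S w (restrict \<nu> (Lx L M s A))"
  using assms(1) Lx_mono[of A B L M s, OF assms(2)] unfolding atomic_def by auto

lemma tp_mem: "X \<in> Lx L M s A \<Longrightarrow> X \<in> tp L M s A a \<longleftrightarrow> a \<in> X"
  by (simp add: tp_def)

text \<open>A type other than those of the atoms can be separated from all of them by a single definable
  set, which then contains no atom and is null.\<close>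

lemma support_atomic:
  assumes at: "atomic L M s A S w \<nu>"
  shows "support L M s A \<nu> = tp L M s A ` S"
proof (intro equalityI subsetI)
  have types: "finite (tp L M s A ` S)" "tp L M s A ` S \<subseteq> types L M s A"
    using at tp_in_types[of _ M s L A] unfolding atomic_def by auto
  fix p assume "p \<in> support L M s A \<nu>"
  then have p: "p \<in> types L M s A" and pos: "\<And>X. X \<in> p \<Longrightarrow> 0 < \<nu> X"
    by (simp_all add: support_def)
  show "p \<in> tp L M s A ` S"
  proof (rule ccontr)
    assume np: "p \<notin> tp L M s A ` S"
    obtain X where X: "X \<in> p" "\<forall>q \<in> tp L M s A ` S. X \<notin> q"
      by (rule types_separated[OF p types np])
    have XL: "X \<in> Lx L M s A" by (rule subsetD[OF type_subset[OF p] X(1)])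
    then have "S \<inter> X = {}" using X(2) by (auto simp: tp_mem)
    then have "\<nu> X = 0" using at XL unfolding atomic_def by simp
    with pos[OF X(1)] show False by simp
  qed
next
  fix p assume "p \<in> tp L M s A ` S"
  then obtain a where a: "a \<in> S" "p = tp L M s A a" by auto
  have "0 < \<nu> X" if X: "X \<in> Lx L M s A" "a \<in> X" for X
  proof -
    have "0 < sum w (S \<inter> X)"
      using at a X unfolding atomic_def by (intro sum_pos) auto
    then show ?thesis using at X unfolding atomic_def by simp
  qed
  moreover have "p \<in> types L M s A" using at a tp_in_types[of a M s L A] unfolding atomic_def by auto
  ultimately show "p \<in> support L M s A \<nu>" by (auto simp: support_def a(2) tp_def)
qed

lemma finite_support_borel_measurable:
  fixes F :: "'a set set \<Rightarrow> real"
  assumes Q: "finite Q" "Q \<subseteq> types L M s A"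
  shows "(\<lambda>p. indicator Q p *\<^sub>R F p) \<in> borel_measurable (type_borel L M s A)"
proof -
  have sing: "{q} \<in> sets (type_borel L M s A)" if "q \<in> Q" for q
    using Q that by (intro finite_in_type_borel) auto
  have "(\<lambda>p. \<Sum>q\<in>Q. indicator {q} p * F q) \<in> borel_measurable (type_borel L M s A)"
    by (intro borel_measurable_sum borel_measurable_times borel_measurable_const
        borel_measurable_indicator sing)
  also have "(\<lambda>p. \<Sum>q\<in>Q. indicator {q} p * F q) = (\<lambda>p. indicator Q p *\<^sub>R F p)"
  proof
    fix p
    have "(\<Sum>q\<in>Q. indicator {q} p * F q) = (\<Sum>q\<in>Q. if p = q then F q else 0)"
      by (intro sum.cong) auto
    also have "\<dots> = indicator Q p *\<^sub>R F p" using Q by (simp add: sum.delta')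
    finally show "(\<Sum>q\<in>Q. indicator {q} p * F q) = indicator Q p *\<^sub>R F p" .
  qed
  finally show ?thesis .
qed

text \<open>The sum of the point masses \<open>w a\<close> at the types \<open>tp(a/A)\<close>, written as an image measure so that
  several atoms may have the same type over a small \<open>A\<close>.\<close>

definition atomic_borel ::
  "('s, 'f, 'r) lang \<Rightarrow> ('s, 'f, 'r, 'a) struct \<Rightarrow> 's \<Rightarrow> ('s \<Rightarrow> 'a set) \<Rightarrow> 'a set \<Rightarrow> ('a \<Rightarrow> real)
    \<Rightarrow> 'a set set measure" where
  "atomic_borel L M s A S w =
     distr (point_measure S (\<lambda>a. ennreal (w a))) (type_borel L M s A) (tp L M s A)"

lemma tp_measurable:
  "S \<subseteq> univ M s \<Longrightarrow> tp L M s A \<in> measurable (point_measure S f) (type_borel L M s A)"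
  using tp_in_types[of _ M s L A] by auto

lemma sets_atomic_borel: "sets (atomic_borel L M s A S w) = sets (type_borel L M s A)"
  by (simp add: atomic_borel_def)

lemma emeasure_atomic_borel:
  assumes at: "atomic L M s A S w \<nu>" and B: "B \<in> sets (type_borel L M s A)"
  shows "emeasure (atomic_borel L M s A S w) B = ennreal (sum w {a \<in> S. tp L M s A a \<in> B})"
proof -
  have S: "finite S" "S \<subseteq> univ M s" "\<And>a. a \<in> S \<Longrightarrow> 0 \<le> w a"
    using at unfolding atomic_def by (auto intro: less_imp_le)
  have "emeasure (atomic_borel L M s A S w) B
      = emeasure (point_measure S (\<lambda>a. ennreal (w a))) (tp L M s A -` B \<inter> S)"
    unfolding atomic_borel_def
    by (subst emeasure_distr[OF tp_measurable[OF S(2)] B]) (simp add: space_point_measure)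
  also have "\<dots> = (\<Sum>a \<in> tp L M s A -` B \<inter> S. ennreal (w a))"
    using S by (intro emeasure_point_measure_finite) auto
  also have "\<dots> = ennreal (sum w (tp L M s A -` B \<inter> S))"
    using S by (intro sum_ennreal) auto
  also have "tp L M s A -` B \<inter> S = {a \<in> S. tp L M s A a \<in> B}" by auto
  finally show ?thesis .
qed

text \<open>Regularity holds because the values are attained: the open set omits only the finitely many
  atoms outside \<open>B\<close>, and the compact set consists of the atoms inside \<open>B\<close>.\<close>

lemma regular_atomic_borel:
  assumes at: "atomic L M s A S w \<nu>"
  shows "regular_measure (type_topology L M s A) (atomic_borel L M s A S w)"
  unfolding regular_measure_def
proof
  fix B assume "B \<in> sets (atomic_borel L M s A S w)"
  then have B: "B \<in> sets (type_borel L M s A)" by (simp add: sets_atomic_borel)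
  let ?m = "emeasure (atomic_borel L M s A S w)"
  have types: "finite (tp L M s A ` S)" "tp L M s A ` S \<subseteq> types L M s A"
    using at tp_in_types[of _ M s L A] unfolding atomic_def by auto
  have B_sub: "B \<subseteq> types L M s A" using sets.sets_into_space[OF B] by simp
  define U where "U = types L M s A - (tp L M s A ` S - B)"
  define K where "K = tp L M s A ` S \<inter> B"
  have U: "openin (type_topology L M s A) U" "B \<subseteq> U"
    unfolding U_def using types B_sub by (auto intro!: openin_compl_finite)
  have K: "compactin (type_topology L M s A) K" "K \<subseteq> B"
    unfolding K_def using types
    by (auto intro!: finite_imp_compactin simp: topspace_type_topology)
  have K_sets: "K \<in> sets (type_borel L M s A)"
    unfolding K_def using types by (intro finite_in_type_borel) auto
  have "{a \<in> S. tp L M s A a \<in> U} = {a \<in> S. tp L M s A a \<in> B}"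
    using types by (auto simp: U_def)
  then have mU: "?m U = ?m B"
    using emeasure_atomic_borel[OF at B] emeasure_atomic_borel[OF at openin_type_borel[OF U(1)]]
    by simp
  have "{a \<in> S. tp L M s A a \<in> K} = {a \<in> S. tp L M s A a \<in> B}" by (auto simp: K_def)
  then have mK: "?m K = ?m B"
    using emeasure_atomic_borel[OF at B] emeasure_atomic_borel[OF at K_sets] by simp
  show "?m B = (INF U \<in> {U. openin (type_topology L M s A) U \<and> B \<subseteq> U}. ?m U) \<and>
     ?m B = (SUP K \<in> {K. compactin (type_topology L M s A) K \<and> K \<subseteq> B}. ?m K)"
  proof (intro conjI antisym)
    show "?m B \<le> (INF U \<in> {U. openin (type_topology L M s A) U \<and> B \<subseteq> U}. ?m U)"
      by (intro INF_greatest emeasure_mono) (auto simp: sets_atomic_borel openin_type_borel)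
    show "(INF U \<in> {U. openin (type_topology L M s A) U \<and> B \<subseteq> U}. ?m U) \<le> ?m B"
      using U by (intro INF_lower2[of U]) (simp_all add: mU)
    show "?m B \<le> (SUP K \<in> {K. compactin (type_topology L M s A) K \<and> K \<subseteq> B}. ?m K)"
      using K by (intro SUP_upper2[of K]) (simp_all add: mK)
    show "(SUP K \<in> {K. compactin (type_topology L M s A) K \<and> K \<subseteq> B}. ?m K) \<le> ?m B"
      using B by (intro SUP_least emeasure_mono) (auto simp: sets_atomic_borel)
  qed
qed

lemma borel_extension_atomic:
  assumes at: "atomic L M s A S w \<nu>"
  shows "borel_extension L M s A \<nu> = atomic_borel L M s A S w"
  unfolding borel_extension_def
proof (rule the_equality)
  let ?m = "atomic_borel L M s A S w"
  have prob: "prob_space ?m"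
  proof
    have "{a \<in> S. tp L M s A a \<in> types L M s A} = S"
      using at tp_in_types[of _ M s L A] unfolding atomic_def by auto
    then show "emeasure ?m (space ?m) = 1"
      using emeasure_atomic_borel[OF at sets.top] at unfolding atomic_def
      by (simp add: atomic_borel_def)
  qed
  have val: "measure ?m (clopen_of L M s A X) = \<nu> X" if X: "X \<in> Lx L M s A" for X
  proof -
    have S: "finite S" "S \<subseteq> univ M s" "\<And>a. a \<in> S \<Longrightarrow> 0 \<le> w a" "\<nu> X = sum w (S \<inter> X)"
      using at X unfolding atomic_def by (auto intro: less_imp_le)
    have "{a \<in> S. tp L M s A a \<in> clopen_of L M s A X} = S \<inter> X"
      using S(2) tp_in_types[of _ M s L A] X by (auto simp: clopen_of_def tp_mem)
    then show ?thesis
      using emeasure_atomic_borel[OF at openin_type_borel[OF openin_clopen_of[OF X]]] S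
        sum_nonneg[of "S \<inter> X" w]
      by (simp add: measure_def)
  qed
  show "space ?m = types L M s A \<and> sets ?m = sets (type_borel L M s A) \<and> prob_space ?m \<and>
     regular_measure (type_topology L M s A) ?m \<and>
     (\<forall>X \<in> Lx L M s A. measure ?m {p \<in> types L M s A. X \<in> p} = \<nu> X)"
    using prob val regular_atomic_borel[OF at] by (simp add: atomic_borel_def clopen_of_def)
  fix m
  assume m: "space m = types L M s A \<and> sets m = sets (type_borel L M s A) \<and> prob_space m \<and>
     regular_measure (type_topology L M s A) m \<and>
     (\<forall>X \<in> Lx L M s A. measure m {p \<in> types L M s A. X \<in> p} = \<nu> X)"
  show "m = ?m"
  proof (rule regular_extension_unique)
    show "finite_measure m" "finite_measure ?m"
      using m prob by (auto simp: prob_space_def)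
    show "measure m (clopen_of L M s A X) = measure ?m (clopen_of L M s A X)"
      if "X \<in> Lx L M s A" for X
      using m val[OF that] that by (simp add: clopen_of_def)
  qed (use m regular_atomic_borel[OF at] in \<open>simp_all add: sets_atomic_borel\<close>)
qed

lemma integral_atomic:
  assumes at: "atomic L M s A S w \<nu>"
  shows "integral\<^sup>L (restrict_space (borel_extension L M s A \<nu>) (support L M s A \<nu>)) F
    = (\<Sum>a\<in>S. w a * F (tp L M s A a))"
proof -
  let ?Q = "support L M s A \<nu>" and ?m = "atomic_borel L M s A S w"
  have S: "finite S" "S \<subseteq> univ M s" "\<And>a. a \<in> S \<Longrightarrow> 0 \<le> w a"
    using at unfolding atomic_def by (auto intro: less_imp_le)
  have Q: "finite ?Q" "?Q \<subseteq> types L M s A"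
    using S tp_in_types[of _ M s L A] by (auto simp: support_atomic[OF at])
  have "?Q \<inter> space ?m \<in> sets ?m"
    using finite_in_type_borel[OF Q] Q(2) by (simp add: atomic_borel_def Int_absorb2)
  then have "integral\<^sup>L (restrict_space ?m ?Q) F = (\<integral>p. indicator ?Q p *\<^sub>R F p \<partial>?m)"
    by (rule integral_restrict_space)
  also have "\<dots> = (\<integral>a. indicator ?Q (tp L M s A a) *\<^sub>R F (tp L M s A a)
      \<partial>point_measure S (\<lambda>a. ennreal (w a)))"
    unfolding atomic_borel_def
    by (intro integral_distr tp_measurable S(2) finite_support_borel_measurable Q)
  also have "\<dots> = (\<Sum>a\<in>S. w a *\<^sub>R (indicator ?Q (tp L M s A a) *\<^sub>R F (tp L M s A a)))"
    using S by (intro lebesgue_integral_point_measure_finite) auto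
  also have "\<dots> = (\<Sum>a\<in>S. w a * F (tp L M s A a))"
    by (intro sum.cong) (auto simp: support_atomic[OF at])
  finally show ?thesis by (simp add: borel_extension_atomic[OF at])
qed

section \<open>Convolution with a finitely atomic measure\<close>

lemma translate_in_Lx:
  assumes G: "expands_group L M g m G" and \<phi>: "\<phi> \<in> xformulas L g (univ M)"
    and d: "d \<in> univ M g"
  shows "translate M g G \<phi> d \<in> Lx L M g (univ M)"
proof -
  from G have grp: "group G" and car: "carrier G = univ M g"
    and m: "m \<in> funs L" "fun_type L m = ([g, g], g)"
    and mult: "\<And>a b. a \<in> univ M g \<Longrightarrow> b \<in> univ M g \<Longrightarrow> fint M m [a, b] = a \<otimes>\<^bsub>G\<^esub> b"
    unfolding expands_group_def by auto
  interpret group G by fact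
  define x z where "x = xvar g" and "z = (g, Suc 0)"
  have xz: "x \<noteq> z" "fst x = g" "fst z = g" by (auto simp: x_def z_def xvar_def)
  \<comment> \<open>The variable \<open>x\<close> is saved in \<open>z\<close> and then rebound to the product. As \<open>x\<close> is the only free
      variable of \<open>\<phi>\<close>, this substitutes \<open>x \<cdot> d\<close> for \<open>x\<close> without any renaming inside \<open>\<phi>\<close>.\<close>
  define \<psi> where "\<psi> = Ex z (Conj (Eq (Var z) (Var x))
    (Ex x (Conj (Eq (Var x) (App m [Var z, Par g d])) \<phi>)))"
  have fv: "fv \<phi> \<subseteq> {x}" and wf: "wf_fm L (univ M) \<phi>"
    using \<phi> by (auto simp: xformulas_def formulas_def x_def)
  have "sat M (e(x := a)) \<psi> \<longleftrightarrow> sat M (e(x := a \<otimes>\<^bsub>G\<^esub> d)) \<phi>" if a: "a \<in> univ M g" for a e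
  proof -
    have ad: "a \<otimes>\<^bsub>G\<^esub> d \<in> univ M g" using a d by (simp flip: car)
    have "sat M (e(x := a)) \<psi> \<longleftrightarrow> sat M (e(x := a, z := a, x := a \<otimes>\<^bsub>G\<^esub> d)) \<phi>"
      using a d ad xz by (auto simp: \<psi>_def mult)
    also have "\<dots> \<longleftrightarrow> sat M (e(x := a \<otimes>\<^bsub>G\<^esub> d)) \<phi>"
      using fv by (intro sat_cong) auto
    finally show ?thesis .
  qed
  moreover have "a \<otimes>\<^bsub>G\<^esub> d \<in> univ M g" if "a \<in> univ M g" for a
    using that d by (simp flip: car)
  ultimately have "translate M g G \<phi> d = solutions M g \<psi>"
    by (auto simp: translate_def solutions_def x_def)
  moreover have "\<psi> \<in> xformulas L g (univ M)"
    using wf fv m d xz by (auto simp: xformulas_def formulas_def \<psi>_def x_def)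
  ultimately show ?thesis unfolding Lx_def by blast
qed

lemma realizes_tp: "d \<in> univ M s \<Longrightarrow> realizes M s d (tp L M s A d)"
  by (simp add: realizes_def tp_def)

text \<open>The integrand is evaluated at an unspecified realization of the type of \<open>b\<close> over \<open>N\<close>;
  since \<open>N\<close> is good, \<open>b\<close> itself gives the same value.\<close>

lemma fiber_integral_atomic:
  assumes at: "atomic L M g (univ M) S w \<nu>" and good: "good_submodel L M \<kappa> g G \<mu> \<nu> \<phi> N"
  shows "fiber_integral L M g G \<mu> \<nu> \<phi> N = (\<Sum>b\<in>S. w b * \<mu> (translate M g G \<phi> b))"
proof -
  have N: "\<And>s. N s \<subseteq> univ M s"
    using good by (simp add: good_submodel_def elementary_sub_def)
  note atN = atomic_restrict[OF at, of N, OF N]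
  have "fiber_value M g G \<mu> \<phi> (tp L M g N b) = \<mu> (translate M g G \<phi> b)" if b: "b \<in> S" for b
  proof -
    have real: "realizes M g b (tp L M g N b)"
      using at b by (intro realizes_tp) (auto simp: atomic_def)
    have "tp L M g N b \<in> support L M g N (restrict \<nu> (Lx L M g N))"
      using b by (simp add: support_atomic[OF atN])
    with good real someI[of "\<lambda>d. realizes M g d (tp L M g N b)", OF real]
    show ?thesis unfolding good_submodel_def fiber_value_def Let_def by blast
  qed
  then show ?thesis
    unfolding fiber_integral_def Let_def integral_atomic[OF atN] by (intro sum.cong) auto
qed

text \<open>When \<open>N\<close> contains the atoms of \<open>\<nu>\<close>, each type in the support of \<open>\<nu>|\<^sub>N\<close> has a single
  realization, and there are finitely many of them; so only the existence of a small \<open>N\<close> matters.\<close>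

lemma star_borel_atomic:
  fixes L :: "('s, 'f, 'r) lang" and M :: "('s, 'f, 'r, 'a) struct"
  assumes mon: "monster_model L T M \<kappa>" and at: "atomic L M g (univ M) S w \<nu>"
  shows "star_borel L M \<kappa> g G \<mu> \<nu>"
  unfolding star_borel_def
proof
  fix \<phi> :: "('s, 'f, 'r, 'a) fm"
  let ?F = "formulas L (\<lambda>_. {}) :: ('s, 'f, 'r, 'a) fm set"
  assume \<phi>: "\<phi> \<in> xformulas L g (univ M)"
  have M: "is_structure L M" and \<kappa>: "|?F| <o \<kappa>"
    using mon by (auto simp: monster_model_def is_model_def)
  have S: "finite S" "S \<subseteq> univ M g" using at by (auto simp: atomic_def)
  define P where "P = params \<phi> \<union> {g} \<times> S"
  have "P \<subseteq> Sigma UNIV (univ M)"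
    using \<phi> S wf_fm_params[of L "univ M" \<phi>] by (auto simp: P_def xformulas_def formulas_def)
  moreover have "finite P" using S finite_params by (auto simp: P_def)
  then have "|P| \<le>o |?F|" using infinite_formulas
    by (metis card_of_Well_order card_of_ordLeq_infinite ordLeq_total)
  ultimately obtain N where N: "elementary_sub L M N" "P \<subseteq> Sigma UNIV N"
    "|Sigma UNIV N| \<le>o |?F|" by (rule downward_Loewenheim_Skolem[OF M])
  have NM: "\<And>s. N s \<subseteq> univ M s" using N(1) by (simp add: elementary_sub_def)
  have SN: "S \<subseteq> N g" using N(2) by (auto simp: P_def)
  note atN = atomic_restrict[OF at, of N, OF NM]
  let ?Q = "support L M g N (restrict \<nu> (Lx L M g N))"
  have Q: "finite ?Q" "?Q \<subseteq> types L M g N"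
    using S tp_in_types[of _ M g L N] by (auto simp: support_atomic[OF atN])
  have unique: "d = a" if "realizes M g d (tp L M g N a)" "a \<in> S" for d a
  proof -
    have "{a} \<in> Lx L M g N" using that SN S by (intro Lx_singleton) auto
    then show ?thesis using that(1) by (auto simp: realizes_def tp_def)
  qed
  have "small \<kappa> N" unfolding small_def using N(3) \<kappa> by (rule ordLeq_ordLess_trans)
  moreover have "\<phi> \<in> xformulas L g N"
    using \<phi> N(2) wf_fm_change_params[of L "univ M" \<phi> N]
    by (auto simp: xformulas_def formulas_def P_def)
  moreover have "fiber_value M g G \<mu> \<phi> \<in> borel_measurable (restrict_space (type_borel L M g N) ?Q)"
    using finite_support_borel_measurable[OF Q] finite_in_type_borel[OF Q] Q(2)
    by (subst borel_measurable_restrict_space_iff) (simp_all add: Int_absorb2)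
  moreover have "\<forall>q \<in> ?Q. \<forall>d d'. realizes M g d q \<longrightarrow> realizes M g d' q \<longrightarrow>
      \<mu> (translate M g G \<phi> d) = \<mu> (translate M g G \<phi> d')"
    unfolding support_atomic[OF atN] by (auto dest!: unique)
  ultimately show "\<exists>N. good_submodel L M \<kappa> g G \<mu> \<nu> \<phi> N"
    using N(1) unfolding good_submodel_def Let_def by blast
qed

text \<open>The formula and the submodel chosen in the definition of the convolution do not show in the
  value, because the translate depends only on the solution set and the atoms do not depend on \<open>N\<close>.\<close>

lemma convolution_atomic:
  assumes sb: "star_borel L M \<kappa> g G \<mu> \<nu>" and at: "atomic L M g (univ M) S w \<nu>"
    and X: "X \<in> Lx L M g (univ M)"
  shows "convolution L M \<kappa> g G \<mu> \<nu> X = (\<Sum>b\<in>S. w b * \<mu> {a \<in> univ M g. a \<otimes>\<^bsub>G\<^esub> b \<in> X})"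
proof -
  define P where "P = (\<lambda>(\<phi>, N). \<phi> \<in> xformulas L g (univ M) \<and> solutions M g \<phi> = X \<and>
     good_submodel L M \<kappa> g G \<mu> \<nu> \<phi> N)"
  obtain \<phi> N where \<phi>N: "(SOME y. P y) = (\<phi>, N)" by (cases "SOME y. P y")
  have "\<exists>y. P y" using sb X unfolding star_borel_def Lx_def P_def by fastforce
  then have "P (\<phi>, N)" unfolding \<phi>N[symmetric] by (rule someI_ex)
  then have *: "solutions M g \<phi> = X" "good_submodel L M \<kappa> g G \<mu> \<nu> \<phi> N"
    by (simp_all add: P_def)
  have "convolution L M \<kappa> g G \<mu> \<nu> X = fiber_integral L M g G \<mu> \<nu> \<phi> N"
    using X \<phi>N unfolding convolution_def P_def by simp
  then show ?thesis
    using fiber_integral_atomic[OF at *(2)] *(1) by (simp add: translate_def)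
qed

section \<open>Measures whose support consists of finitely many realized types\<close>

lemma keisler_additive:
  "\<mu> \<in> keisler_measures L M s A \<Longrightarrow> X \<in> Lx L M s A \<Longrightarrow> Y \<in> Lx L M s A \<Longrightarrow> X \<inter> Y = {} \<Longrightarrow>
    \<mu> (X \<union> Y) = \<mu> X + \<mu> Y"
  by (simp add: keisler_measures_def)

lemma keisler_nonneg: "\<mu> \<in> keisler_measures L M s A \<Longrightarrow> X \<in> Lx L M s A \<Longrightarrow> 0 \<le> \<mu> X"
  by (simp add: keisler_measures_def)

lemma keisler_empty: "\<mu> \<in> keisler_measures L M s A \<Longrightarrow> \<mu> {} = 0"
  using keisler_additive[of \<mu> L M s A "{}" "{}"] Lx_empty[of L M s A] by simp

lemma keisler_split:
  assumes \<mu>: "\<mu> \<in> keisler_measures L M s A" and X: "X \<in> Lx L M s A" and Y: "Y \<in> Lx L M s A"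
  shows "\<mu> X = \<mu> (X \<inter> Y) + \<mu> (X - Y)"
proof -
  have "X - Y = X \<inter> (univ M s - Y)" using Lx_subset[OF X] by auto
  then have "X - Y \<in> Lx L M s A" using Lx_Int[OF X Lx_Diff[OF Y]] by simp
  moreover have "(X \<inter> Y) \<union> (X - Y) = X" by auto
  ultimately show ?thesis using keisler_additive[OF \<mu> Lx_Int[OF X Y], of "X - Y"] by auto
qed

lemma keisler_mono:
  assumes \<mu>: "\<mu> \<in> keisler_measures L M s A" and X: "X \<in> Lx L M s A" and Y: "Y \<in> Lx L M s A"
    and "X \<subseteq> Y"
  shows "\<mu> X \<le> \<mu> Y"
proof -
  have "Y - X = Y \<inter> (univ M s - X)" using Lx_subset[OF Y] by auto
  then have "Y - X \<in> Lx L M s A" using Lx_Int[OF Y Lx_Diff[OF X]] by simp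
  moreover have "Y \<inter> X = X" using assms(4) by auto
  ultimately show ?thesis using keisler_split[OF \<mu> Y X] keisler_nonneg[OF \<mu>] by fastforce
qed

lemma keisler_finite:
  assumes \<mu>: "\<mu> \<in> keisler_measures L M s (univ M)" and "finite F" "F \<subseteq> univ M s"
  shows "\<mu> F = (\<Sum>a\<in>F. \<mu> {a})"
  using assms(2,3)
proof (induction F rule: finite_induct)
  case empty
  then show ?case using keisler_empty[OF \<mu>] by simp
next
  case (insert a F)
  have "{a} \<in> Lx L M s (univ M)" "F \<in> Lx L M s (univ M)"
    using insert by (auto intro!: Lx_finite)
  then have "\<mu> ({a} \<union> F) = \<mu> {a} + \<mu> F"
    using insert by (intro keisler_additive[OF \<mu>]) auto
  then show ?case using insert by simp
qed

text \<open>A maximal family containing \<open>Y\<close> all of whose finite intersections have positive measure is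
  a type: if it could be extended neither by \<open>X\<close> nor by the complement of \<open>X\<close>, then a set of
  positive measure would be covered by two null sets.\<close>

lemma positive_imp_in_support_type:
  assumes \<mu>: "\<mu> \<in> keisler_measures L M s A" and Y: "Y \<in> Lx L M s A" "0 < \<mu> Y"
  shows "\<exists>p \<in> support L M s A \<mu>. Y \<in> p"
proof -
  define I where "I F = Y \<inter> \<Inter>F" for F
  define \<A> where "\<A> = {p. p \<subseteq> Lx L M s A \<and> (\<forall>F. finite F \<longrightarrow> F \<subseteq> p \<longrightarrow> 0 < \<mu> (I F))}"
  have I_Lx: "I F \<in> Lx L M s A" if "finite F" "F \<subseteq> Lx L M s A" for F
    using that
  proof (induction F rule: finite_induct)
    case (insert X F)
    have "I (insert X F) = X \<inter> I F" by (auto simp: I_def)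
    then show ?case using insert by (auto intro: Lx_Int)
  qed (use Y in \<open>simp add: I_def\<close>)
  have "\<exists>p\<in>\<A>. \<forall>q\<in>\<A>. p \<subseteq> q \<longrightarrow> q = p"
  proof (rule subset_Zorn_nonempty)
    have "{} \<in> \<A>" using Y by (auto simp: \<A>_def I_def)
    then show "\<A> \<noteq> {}" by blast
  next
    fix \<C> assume \<C>: "\<C> \<noteq> {}" "subset.chain \<A> \<C>"
    have "0 < \<mu> (I F)" if F: "finite F" "F \<subseteq> \<Union>\<C>" for F
    proof -
      obtain p where "p \<in> \<C>" "F \<subseteq> p"
        using finite_subset_Union_chain[OF F \<C>] by blast
      then show ?thesis using \<C>(2) F(1) by (auto simp: \<A>_def subset.chain_def)
    qed
    moreover have "\<Union>\<C> \<subseteq> Lx L M s A" using \<C>(2) by (auto simp: \<A>_def subset.chain_def)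
    ultimately show "\<Union>\<C> \<in> \<A>" by (simp add: \<A>_def)
  qed
  then obtain p where p: "p \<in> \<A>" and max: "\<And>q. q \<in> \<A> \<Longrightarrow> p \<subseteq> q \<Longrightarrow> q = p" by auto
  have pL: "p \<subseteq> Lx L M s A" and pos: "\<And>F. finite F \<Longrightarrow> F \<subseteq> p \<Longrightarrow> 0 < \<mu> (I F)"
    using p by (auto simp: \<A>_def)
  have ext: "\<exists>F. finite F \<and> F \<subseteq> p \<and> \<mu> (I F \<inter> X) \<le> 0" if X: "X \<in> Lx L M s A" "X \<notin> p" for X
  proof -
    have "insert X p \<notin> \<A>" using max[of "insert X p"] X by auto
    then obtain F where F: "finite F" "F \<subseteq> insert X p" "\<mu> (I F) \<le> 0"
      using X pL by (auto simp: \<A>_def not_less)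
    have FL: "F \<subseteq> Lx L M s A" "F - {X} \<subseteq> Lx L M s A" using F X pL by auto
    have "I (F - {X}) \<inter> X \<subseteq> I F" by (auto simp: I_def)
    then have "\<mu> (I (F - {X}) \<inter> X) \<le> \<mu> (I F)"
      using F FL X by (intro keisler_mono[OF \<mu>] Lx_Int I_Lx) auto
    then show ?thesis using F by (intro exI[of _ "F - {X}"]) auto
  qed
  have decide: "X \<in> p \<or> univ M s - X \<in> p" if X: "X \<in> Lx L M s A" for X
  proof (rule ccontr)
    assume n: "\<not> ?thesis"
    then obtain F F' where F: "finite F" "F \<subseteq> p" "\<mu> (I F \<inter> X) \<le> 0"
      and F': "finite F'" "F' \<subseteq> p" "\<mu> (I F' \<inter> (univ M s - X)) \<le> 0"
      using ext[OF X] ext[OF Lx_Diff[OF X]] by auto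
    have L: "I F \<in> Lx L M s A" "I F' \<in> Lx L M s A" "I (F \<union> F') \<in> Lx L M s A"
      using F F' pL by (auto intro!: I_Lx)
    have "\<mu> (I (F \<union> F') \<inter> X) \<le> \<mu> (I F \<inter> X)"
      using L X by (intro keisler_mono[OF \<mu>] Lx_Int) (auto simp: I_def)
    moreover have "\<mu> (I (F \<union> F') - X) \<le> \<mu> (I F' \<inter> (univ M s - X))"
    proof -
      have "I (F \<union> F') - X = I (F \<union> F') \<inter> (univ M s - X)" using Lx_subset[OF L(3)] by auto
      also have "\<mu> \<dots> \<le> \<mu> (I F' \<inter> (univ M s - X))"
        using L X by (intro keisler_mono[OF \<mu>] Lx_Int Lx_Diff) (auto simp: I_def)
      finally show ?thesis .
    qed
    ultimately have "\<mu> (I (F \<union> F')) \<le> 0"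
      using keisler_split[OF \<mu> L(3) X] F(3) F'(3) by simp
    moreover have "0 < \<mu> (I (F \<union> F'))" using F F' by (intro pos) auto
    ultimately show False by simp
  qed
  have "p \<in> types L M s A"
    unfolding types_def
  proof (intro CollectI conjI allI impI ballI)
    fix F assume F: "finite F" "F \<subseteq> p"
    have "I F \<noteq> {}" using pos[OF F] keisler_empty[OF \<mu>] by auto
    then show "\<exists>a \<in> univ M s. \<forall>X \<in> F. a \<in> X" using Lx_subset[OF Y(1)] by (auto simp: I_def)
  qed (use pL decide in auto)
  moreover have "0 < \<mu> X" if X: "X \<in> p" for X
  proof -
    have "\<mu> (I {X}) \<le> \<mu> X"
      using X pL Y by (intro keisler_mono[OF \<mu> I_Lx]) (auto simp: I_def)
    then show ?thesis using pos[of "{X}"] X by auto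
  qed
  moreover have "Y \<in> p"
  proof (rule ccontr)
    assume "Y \<notin> p"
    then have "univ M s - Y \<in> p" using decide[OF Y(1)] by auto
    moreover have "I {univ M s - Y} = {}" by (auto simp: I_def)
    ultimately show False using pos[of "{univ M s - Y}"] keisler_empty[OF \<mu>] by auto
  qed
  ultimately show ?thesis unfolding support_def by auto
qed

text \<open>The set \<open>S\<close> of points of positive measure is finite since it embeds into the support. Its
  complement is null: otherwise it would belong to a type of the support, which is the type of some
  \<open>a\<close> outside \<open>S\<close>, and then \<open>{a}\<close> would have positive measure.\<close>

lemma finite_realized_support_imp_atomic:
  assumes \<mu>: "\<mu> \<in> keisler_measures L M g (univ M)"
    and fin: "finite (support L M g (univ M) \<mu>)"
    and real: "support L M g (univ M) \<mu> \<subseteq> tp L M g (univ M) ` univ M g"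
  shows "atomic L M g (univ M) {a \<in> univ M g. 0 < \<mu> {a}} (\<lambda>a. \<mu> {a}) \<mu>"
proof -
  define S where "S = {a \<in> univ M g. 0 < \<mu> {a}}"
  let ?L = "Lx L M g (univ M)"
  have sing: "{a} \<in> ?L" if "a \<in> univ M g" for a using that by (intro Lx_singleton)
  have "tp L M g (univ M) ` S \<subseteq> support L M g (univ M) \<mu>"
  proof clarify
    fix a assume a: "a \<in> S"
    have "0 < \<mu> X" if "X \<in> ?L" "a \<in> X" for X
      using keisler_mono[OF \<mu> sing that(1), of a] a that by (auto simp: S_def)
    then show "tp L M g (univ M) a \<in> support L M g (univ M) \<mu>"
      using a tp_in_types[of a M g L "univ M"] by (auto simp: support_def S_def tp_def)
  qed
  moreover have "inj_on (tp L M g (univ M)) S"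
  proof (rule inj_onI)
    fix a b assume "a \<in> S" "b \<in> S" "tp L M g (univ M) a = tp L M g (univ M) b"
    moreover have "{a} \<in> tp L M g (univ M) a" using sing \<open>a \<in> S\<close> by (auto simp: tp_def S_def)
    ultimately show "a = b" by (auto simp: tp_def)
  qed
  ultimately have S: "finite S" "S \<subseteq> univ M g"
    using inj_on_finite[OF _ _ fin] by (auto simp: S_def)
  have SL: "S \<in> ?L" using S by (intro Lx_finite)
  have null: "\<mu> (univ M g - S) = 0"
  proof (rule ccontr)
    assume "\<mu> (univ M g - S) \<noteq> 0"
    then have "0 < \<mu> (univ M g - S)" using keisler_nonneg[OF \<mu> Lx_Diff[OF SL]] by simp
    then obtain p where p: "p \<in> support L M g (univ M) \<mu>" "univ M g - S \<in> p"
      using positive_imp_in_support_type[OF \<mu> Lx_Diff[OF SL]] by auto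
    then obtain a where a: "a \<in> univ M g" "p = tp L M g (univ M) a" using real by auto
    have "{a} \<in> p" using sing a by (simp add: tp_def)
    then have "0 < \<mu> {a}" using p(1) by (auto simp: support_def)
    moreover have "a \<notin> S" using p(2) by (simp add: a(2) tp_def)
    ultimately show False using a(1) by (auto simp: S_def)
  qed
  have val: "\<mu> X = (\<Sum>a \<in> S \<inter> X. \<mu> {a})" if X: "X \<in> ?L" for X
  proof -
    have "X - S = X \<inter> (univ M g - S)" using Lx_subset[OF X] by auto
    then have XS: "X - S \<in> ?L" using Lx_Int[OF X Lx_Diff[OF SL]] by simp
    have "\<mu> (X - S) \<le> \<mu> (univ M g - S)"
      using XS SL Lx_subset[OF X] by (intro keisler_mono[OF \<mu>] Lx_Diff) auto
    then have "\<mu> (X - S) = 0" using null keisler_nonneg[OF \<mu> XS] by simp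
    then have "\<mu> X = \<mu> (X \<inter> S)" using keisler_split[OF \<mu> X SL] by simp
    also have "\<dots> = (\<Sum>a \<in> X \<inter> S. \<mu> {a})" using S by (intro keisler_finite[OF \<mu>]) auto
    finally show ?thesis by (simp add: Int_commute)
  qed
  have "\<mu> (univ M g) = 1" using \<mu> by (simp add: keisler_measures_def)
  then have "sum (\<lambda>a. \<mu> {a}) S = 1" using val[OF Lx_univ] S(2) by (simp add: Int_absorb2)
  then have "atomic L M g (univ M) S (\<lambda>a. \<mu> {a}) \<mu>"
    unfolding atomic_def using S val by (simp add: S_def)
  then show ?thesis by (simp add: S_def)
qed

section \<open>Idempotent weights on a finite subset of a group\<close>

text \<open>Right multiplication by an element of \<open>S\<close> is injective on the finite set \<open>S\<close>, hence
  surjective; this yields the unit and the inverses.\<close>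

lemma (in group) finite_mult_closed_imp_subgroup:
  assumes S: "finite S" "S \<noteq> {}" "S \<subseteq> carrier G"
    and closed: "\<And>a b. a \<in> S \<Longrightarrow> b \<in> S \<Longrightarrow> a \<otimes> b \<in> S"
  shows "subgroup S G"
proof -
  have surj: "\<exists>b \<in> S. b \<otimes> a = c" if "a \<in> S" "c \<in> S" for a c
  proof -
    have "inj_on (\<lambda>b. b \<otimes> a) S"
    proof (rule inj_onI)
      fix x y assume "x \<in> S" "y \<in> S" "x \<otimes> a = y \<otimes> a"
      moreover have "x \<in> carrier G" "y \<in> carrier G" "a \<in> carrier G"
        using S(3) that(1) calculation(1,2) by blast+
      ultimately show "x = y" by simp
    qed
    then have "(\<lambda>b. b \<otimes> a) ` S = S"
      using S closed that by (intro endo_inj_surj) auto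
    then show ?thesis using that by (metis imageE)
  qed
  obtain a where a: "a \<in> S" using S by auto
  have one: "\<one> \<in> S"
  proof -
    obtain b where b: "b \<in> S" "b \<otimes> a = a" using surj[OF a a] by blast
    have "b = \<one>" using b a S by (metis r_cancel_one subsetD)
    with b show ?thesis by simp
  qed
  show ?thesis
  proof (rule subgroupI)
    fix x assume x: "x \<in> S"
    obtain b where b: "b \<in> S" "b \<otimes> x = \<one>" using surj[OF x one] by blast
    have "inv x = b" using b x S inv_equality by blast
    with b show "inv x \<in> S" by simp
  qed (use S closed in auto)
qed

text \<open>Products of atoms are atoms, as one term of the sum for \<open>w (a \<cdot> b)\<close> is \<open>w a * w b\<close>. At an
  element \<open>c\<close> of maximal weight, \<open>w c\<close> is a weighted average of the weights at the
  \<open>c \<cdot> b\<^sup>-\<^sup>1\<close>, all of which are at most \<open>w c\<close>; so they are all equal to it.\<close>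

lemma (in group) idempotent_weights:
  fixes w :: "'a \<Rightarrow> real"
  assumes S: "finite S" "S \<subseteq> carrier G" and pos: "\<And>a. a \<in> S \<Longrightarrow> 0 < w a" and one: "sum w S = 1"
    and idem: "\<And>c. c \<in> carrier G \<Longrightarrow>
      sum w (S \<inter> {c}) = (\<Sum>b\<in>S. w b * sum w (S \<inter> {a \<in> carrier G. a \<otimes> b \<in> {c}}))"
  shows "subgroup S G" and "a \<in> S \<Longrightarrow> w a = 1 / card S"
proof -
  define v where "v c = (if c \<in> S then w c else 0)" for c
  have v: "0 \<le> v c" "c \<in> S \<Longrightarrow> v c = w c" for c using pos by (auto simp: v_def less_imp_le)
  have single: "sum w (S \<inter> {c}) = v c" for c by (auto simp: v_def)
  have eq: "v c = (\<Sum>b\<in>S. w b * v (c \<otimes> inv b))" if c: "c \<in> carrier G" for c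
  proof -
    have "{a \<in> carrier G. a \<otimes> b \<in> {c}} = {c \<otimes> inv b}" if "b \<in> S" for b
    proof -
      have b: "b \<in> carrier G" using that S by auto
      have "a \<otimes> b = c \<longleftrightarrow> a = c \<otimes> inv b" if "a \<in> carrier G" for a
        using that b c by (metis inv_closed inv_solve_right)
      then show ?thesis using b c by auto
    qed
    then show ?thesis using idem[OF c] by (simp add: single)
  qed
  have closed: "a \<otimes> b \<in> S" if a: "a \<in> S" and b: "b \<in> S" for a b
  proof -
    have car: "a \<in> carrier G" "b \<in> carrier G" using a b S by auto
    have "0 < w b * v (a \<otimes> b \<otimes> inv b)"
      using a b car pos by (simp add: m_assoc v)
    also have "\<dots> \<le> (\<Sum>b'\<in>S. w b' * v (a \<otimes> b \<otimes> inv b'))"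
      by (rule member_le_sum[OF b _ S(1)]) (use v pos in \<open>auto intro!: mult_nonneg_nonneg intro: less_imp_le\<close>)
    also have "\<dots> = v (a \<otimes> b)" using car by (intro eq[symmetric]) auto
    finally show ?thesis by (auto simp: v_def split: if_splits)
  qed
  have ne: "S \<noteq> {}" using one by auto
  show sub: "subgroup S G" by (rule finite_mult_closed_imp_subgroup[OF S(1) ne S(2) closed])
  obtain c where c: "c \<in> S" and max: "\<And>a. a \<in> S \<Longrightarrow> w a \<le> w c"
  proof -
    have "Max (w ` S) \<in> w ` S" using S ne by (intro Max_in) auto
    then obtain c where "c \<in> S" "w c = Max (w ` S)" by auto
    moreover have "w a \<le> Max (w ` S)" if "a \<in> S" for a using S that by (intro Max_ge) auto
    ultimately show thesis using that by simp
  qed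
  have le: "v a \<le> w c" for a using max pos[OF c] by (auto simp: v_def less_imp_le)
  have "w c * sum w S = (\<Sum>b\<in>S. w b * v (c \<otimes> inv b))"
    using eq[of c] c S v one by auto
  then have "(\<Sum>b\<in>S. w b * (w c - v (c \<otimes> inv b))) = 0"
    by (simp add: right_diff_distrib sum_subtractf sum_distrib_left mult.commute)
  then have "\<forall>b\<in>S. w b * (w c - v (c \<otimes> inv b)) = 0"
    using S(1) le by (subst (asm) sum_nonneg_eq_0_iff) (auto simp: less_imp_le[OF pos])
  then have at: "v (c \<otimes> inv b) = w c" if "b \<in> S" for b using that pos by fastforce
  have const: "w a = w c" if a: "a \<in> S" for a
  proof -
    have car: "a \<in> carrier G" "c \<in> carrier G" using a c S by auto
    have b: "inv a \<otimes> c \<in> S"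
      using subgroup.m_closed[OF sub subgroup.m_inv_closed[OF sub a] c] .
    have "c \<otimes> inv (inv a \<otimes> c) = a" using car by (simp add: inv_mult_group m_assoc[symmetric])
    then show ?thesis using at[OF b] v a by simp
  qed
  then have "card S * w c = 1" using one by simp
  then show "w a = 1 / card S" if "a \<in> S"
    using const[OF that] ne S by (simp add: field_simps)
qed

lemma (in group) card_Int_right_translate:
  assumes H: "subgroup H G" and b: "b \<in> H"
  shows "card (H \<inter> {a \<in> carrier G. a \<otimes> b \<in> X}) = card (H \<inter> X)"
proof (rule bij_betw_same_card)
  have sub: "H \<subseteq> carrier G" by (rule subgroup.subset[OF H])
  show "bij_betw (\<lambda>a. a \<otimes> b) (H \<inter> {a \<in> carrier G. a \<otimes> b \<in> X}) (H \<inter> X)"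
  proof (rule bij_betw_byWitness[where f' = "\<lambda>a. a \<otimes> inv b"])
    show "\<forall>a \<in> H \<inter> {a \<in> carrier G. a \<otimes> b \<in> X}. a \<otimes> b \<otimes> inv b = a"
      using b sub by (auto simp: m_assoc)
    show "\<forall>a \<in> H \<inter> X. a \<otimes> inv b \<otimes> b = a"
      using b sub by (auto simp: m_assoc subset_iff)
    show "(\<lambda>a. a \<otimes> b) ` (H \<inter> {a \<in> carrier G. a \<otimes> b \<in> X}) \<subseteq> H \<inter> X"
      using b subgroup.m_closed[OF H] by auto
    show "(\<lambda>a. a \<otimes> inv b) ` (H \<inter> X) \<subseteq> H \<inter> {a \<in> carrier G. a \<otimes> b \<in> X}"
      using b sub subgroup.m_closed[OF H] subgroup.m_inv_closed[OF H]
      by (auto simp: m_assoc subset_iff)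
  qed
qed

section \<open>Idempotent measures with finite support\<close>

lemma right_translate_in_Lx:
  assumes "expands_group L M g m G" "X \<in> Lx L M g (univ M)" "d \<in> univ M g"
  shows "{a \<in> univ M g. a \<otimes>\<^bsub>G\<^esub> d \<in> X} \<in> Lx L M g (univ M)"
proof -
  obtain \<phi> where "\<phi> \<in> xformulas L g (univ M)" "X = solutions M g \<phi>"
    using assms(2) by (auto simp: Lx_def)
  then show ?thesis using translate_in_Lx[OF assms(1) _ assms(3)] by (simp add: translate_def)
qed

lemma idempotent_atomic_iff:
  assumes mon: "monster_model L T M \<kappa>" and G: "expands_group L M g m G"
    and at: "atomic L M g (univ M) S w \<mu>" and ext: "\<mu> \<in> extensional (Lx L M g (univ M))"
  shows "idempotent_measure L M \<kappa> g G \<mu> \<longleftrightarrow> (\<forall>X \<in> Lx L M g (univ M).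
    sum w (S \<inter> X) = (\<Sum>b\<in>S. w b * sum w (S \<inter> {a \<in> univ M g. a \<otimes>\<^bsub>G\<^esub> b \<in> X})))"
proof -
  note sb = star_borel_atomic[OF mon at, of G \<mu>]
  have S: "S \<subseteq> univ M g" and val: "\<And>X. X \<in> Lx L M g (univ M) \<Longrightarrow> \<mu> X = sum w (S \<inter> X)"
    using at by (auto simp: atomic_def)
  have conv: "convolution L M \<kappa> g G \<mu> \<mu> X
      = (\<Sum>b\<in>S. w b * sum w (S \<inter> {a \<in> univ M g. a \<otimes>\<^bsub>G\<^esub> b \<in> X}))"
    if X: "X \<in> Lx L M g (univ M)" for X
    unfolding convolution_atomic[OF sb at X]
    using S right_translate_in_Lx[OF G X] by (intro sum.cong) (auto simp: val)
  have ext': "convolution L M \<kappa> g G \<mu> \<mu> \<in> extensional (Lx L M g (univ M))"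
    unfolding convolution_def by simp
  have "convolution L M \<kappa> g G \<mu> \<mu> = \<mu> \<longleftrightarrow>
      (\<forall>X \<in> Lx L M g (univ M). convolution L M \<kappa> g G \<mu> \<mu> X = \<mu> X)"
    using extensionalityI[OF ext' ext] by auto
  then show ?thesis using sb unfolding idempotent_measure_def by (auto simp: conv val)
qed

theorem proposition3p22:
  fixes L :: "('s, 'f, 'r) lang"
    and T :: "('s, 'f, 'r, 'a) fm set"
    and M :: "('s, 'f, 'r, 'a) struct"
    and \<kappa> :: "'k rel"
    and g :: 's and m :: 'f
    and G :: "'a monoid"
    and \<mu> :: "'a set \<Rightarrow> real"
  assumes "monster_model L T M \<kappa>"
    and "expands_group L M g m G"
    and "\<mu> \<in> keisler_measures L M g (univ M)"
    and "finite (support L M g (univ M) \<mu>)"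
    and "support L M g (univ M) \<mu> \<subseteq> tp L M g (univ M) ` univ M g"
  shows "idempotent_measure L M \<kappa> g G \<mu> \<longleftrightarrow>
    (\<exists>H. subgroup H G \<and> finite H \<and>
         \<mu> = (\<lambda>X \<in> Lx L M g (univ M). (1 / real (card H)) * (\<Sum>a\<in>H. dirac L M g a X)))"
proof -
  note mon = assms(1) and G = assms(2)
  interpret group G using G by (simp add: expands_group_def)
  have car: "carrier G = univ M g" using G by (simp add: expands_group_def)
  let ?L = "Lx L M g (univ M)"
  have ext: "\<mu> \<in> extensional ?L" using assms(3) by (simp add: keisler_measures_def)
  have dirac: "(\<Sum>a\<in>H. dirac L M g a X) = real (card (H \<inter> X))"
    if "finite H" "X \<in> ?L" for H X
  proof -
    have "(\<Sum>a\<in>H. dirac L M g a X) = (\<Sum>a\<in>H. if a \<in> X then 1 else 0)"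
      using that(2) by (simp add: dirac_def)
    also have "\<dots> = real (card (H \<inter> X))" using that(1) by (simp flip: sum.inter_restrict)
    finally show ?thesis .
  qed
  show ?thesis
  proof
    assume idem: "idempotent_measure L M \<kappa> g G \<mu>"
    define S w where "S = {a \<in> univ M g. 0 < \<mu> {a}}" and "w = (\<lambda>a. \<mu> {a})"
    have at: "atomic L M g (univ M) S w \<mu>"
      unfolding S_def w_def by (rule finite_realized_support_imp_atomic[OF assms(3-5)])
    have S: "finite S" "S \<subseteq> carrier G" "\<And>a. a \<in> S \<Longrightarrow> 0 < w a" "sum w S = 1"
      using at by (auto simp: atomic_def car)
    have eq: "sum w (S \<inter> {c}) = (\<Sum>b\<in>S. w b * sum w (S \<inter> {a \<in> carrier G. a \<otimes>\<^bsub>G\<^esub> b \<in> {c}}))"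
      if "c \<in> carrier G" for c
      using idem that Lx_singleton[of c "univ M" g M L]
      unfolding idempotent_atomic_iff[OF mon G at ext] by (simp only: car)
    have H: "subgroup S G" and w: "\<And>a. a \<in> S \<Longrightarrow> w a = 1 / card S"
      using idempotent_weights[OF S eq] by blast+
    have "\<mu> X = 1 / real (card S) * (\<Sum>a\<in>S. dirac L M g a X)" if X: "X \<in> ?L" for X
    proof -
      have "\<mu> X = sum w (S \<inter> X)" using at X by (simp add: atomic_def)
      also have "\<dots> = (\<Sum>a \<in> S \<inter> X. 1 / card S)" by (intro sum.cong) (auto simp: w)
      finally show ?thesis using dirac[OF S(1) X] by simp
    qed
    then have "\<mu> = (\<lambda>X \<in> ?L. 1 / real (card S) * (\<Sum>a\<in>S. dirac L M g a X))"
      by (intro extensionalityI[OF ext]) auto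
    with H S(1) show "\<exists>H. subgroup H G \<and> finite H \<and>
         \<mu> = (\<lambda>X \<in> ?L. (1 / real (card H)) * (\<Sum>a\<in>H. dirac L M g a X))" by blast
  next
    assume "\<exists>H. subgroup H G \<and> finite H \<and>
         \<mu> = (\<lambda>X \<in> ?L. (1 / real (card H)) * (\<Sum>a\<in>H. dirac L M g a X))"
    then obtain H where H: "subgroup H G" "finite H"
      and \<mu>: "\<mu> = (\<lambda>X \<in> ?L. (1 / real (card H)) * (\<Sum>a\<in>H. dirac L M g a X))" by blast
    let ?w = "\<lambda>_::'a. 1 / real (card H)"
    have card: "0 < card H" using H subgroup.one_closed[OF H(1)] by (auto simp: card_gt_0_iff)
    have "H \<subseteq> univ M g" using subgroup.subset[OF H(1)] by (simp add: car)
    then have at: "atomic L M g (univ M) H ?w \<mu>"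
      unfolding atomic_def using H(2) card by (auto simp: \<mu> dirac)
    show "idempotent_measure L M \<kappa> g G \<mu>"
      unfolding idempotent_atomic_iff[OF mon G at ext]
    proof
      fix X
      have "(\<Sum>b\<in>H. ?w b * sum ?w (H \<inter> {a \<in> univ M g. a \<otimes>\<^bsub>G\<^esub> b \<in> X}))
          = (\<Sum>b\<in>H. ?w b * (card (H \<inter> X) / card H))"
        using card_Int_right_translate[OF H(1), of _ X] by (intro sum.cong) (auto simp flip: car)
      then show "sum ?w (H \<inter> X)
          = (\<Sum>b\<in>H. ?w b * sum ?w (H \<inter> {a \<in> univ M g. a \<otimes>\<^bsub>G\<^esub> b \<in> X}))"
        using card by simp
    qed
  qed
qed

end
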